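(* Let $r\ge 3$, $l\ge 4$ and $s\ge 1$ be integers. (i) If either $l=2t$ and $r\ge s+2$, or $l=2t+1$ and $r\ge s+3$, for some integer $t\ge 2$, then $\mathrm{mex}(m,K_r,K_s\vee C_l)=O\!\left(m^{\frac{s+1}{2}+\frac{1}{2t}}\right)$. (ii) Otherwise, $\mathrm{mex}(m,K_r,K_s\vee C_l)=\Theta(m^{r/2})$.
   Context: $\mathrm{mex}(m,K_r,F)$ is the maximum number of copies of $K_r$ in an $F$-free simple graph with $m$ edges. $C_l$ is the cycle on $l$ vertices. For graphs $G,H$, $G\vee H$ is the graph on $V(G)\cup V(H)$ (disjoint) with edge set $E(G)\cup E(H)\cup\{xy: x\in V(G), y\in V(H)\}$. Asymptotics are as $m\to\infty$. *)

theory Defs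
  imports Complex_Main "HOL-Library.Landau_Symbols"
begin

datatype 'a sgraph = SGraph (verts: "'a set") (edges: "'a set set")

definition simple_graph :: "'a sgraph \<Rightarrow> bool" where
  "simple_graph G \<longleftrightarrow> finite (verts G) \<and> edges G \<subseteq> {e. e \<subseteq> verts G \<and> card e = 2}"

definition complete_graph :: "nat \<Rightarrow> nat sgraph" where
  "complete_graph r = SGraph {..<r} {e. e \<subseteq> {..<r} \<and> card e = 2}"

text \<open>A simple graph, and then the cycle on \<open>l\<close> vertices, only for \<open>l \<ge> 3\<close>.\<close>

definition cycle_graph :: "nat \<Rightarrow> nat sgraph" where
  "cycle_graph l = SGraph {..<l} {{i, Suc i mod l} | i. i < l}"

definition graph_join :: "'a sgraph \<Rightarrow> 'b sgraph \<Rightarrow> ('a + 'b) sgraph" where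
  "graph_join G H = SGraph (verts G <+> verts H)
     ((\<lambda>e. Inl ` e) ` edges G \<union> (\<lambda>e. Inr ` e) ` edges H
       \<union> {{Inl x, Inr y} | x y. x \<in> verts G \<and> y \<in> verts H})"

definition subgraph :: "'a sgraph \<Rightarrow> 'a sgraph \<Rightarrow> bool" where
  "subgraph H G \<longleftrightarrow> simple_graph H \<and> verts H \<subseteq> verts G \<and> edges H \<subseteq> edges G"

definition graph_iso :: "'a sgraph \<Rightarrow> 'b sgraph \<Rightarrow> bool" where
  "graph_iso G H \<longleftrightarrow>
     (\<exists>f. bij_betw f (verts G) (verts H) \<and> edges H = (\<lambda>e. f ` e) ` edges G)"

text \<open>Copies are subgraphs, not necessarily induced; two embeddings with the same image
  give the same copy.\<close>

definition copies :: "'a sgraph \<Rightarrow> 'b sgraph \<Rightarrow> 'b sgraph set" where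
  "copies H G = {H'. subgraph H' G \<and> graph_iso H H'}"

definition graph_free :: "'a sgraph \<Rightarrow> 'b sgraph \<Rightarrow> bool" where
  "graph_free F G \<longleftrightarrow> copies F G = {}"

text \<open>Host graphs have vertices in \<^typ>\<open>nat\<close>, which covers all finite graphs up to
  isomorphism. The number of vertices is not bounded, so the maximum is over a finite set
  only if \<open>H\<close> has no isolated vertices (then every copy of \<open>H\<close> lies on the at most \<open>2 m\<close>
  non-isolated vertices); for \<open>H = K\<^sub>r\<close> this means \<open>r \<ge> 2\<close>. The set is nonempty as soon as a
  matching with \<open>m\<close> edges is \<open>F\<close>-free.\<close>

definition mex :: "nat \<Rightarrow> 'a sgraph \<Rightarrow> 'b sgraph \<Rightarrow> nat" where
  "mex m H F = Max {card (copies H G) | G :: nat sgraph.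
     simple_graph G \<and> card (edges G) = m \<and> graph_free F G}"

end

theory Submission imports Defs "HOL-Library.FuncSet" begin

text \<open>Upper bounds: a vertex of minimum degree in a clique sees the rest of the clique inside a set
  of at most \<open>sqrt (2m)\<close> neighbours, and this neighbourhood is \<open>K\<^bsub>s-1\<^esub> \<or> C\<^sub>l\<close>-free. So it suffices to
  show that an \<open>n\<close>-vertex \<open>K\<^sub>s \<or> C\<^sub>l\<close>-free graph has \<open>O(n\<^bsup>s+1+1/t\<^esup>)\<close> cliques \<open>K\<^sub>r\<close>; passing to
  neighbourhoods reduces this to \<open>s = 0\<close>. There neighbourhoods contain no long paths, hence are
  degenerate, and the cliques are bounded by the number of edges, or of edges in triangles
  if \<open>l\<close> is odd. For \<open>l = 2t\<close> these are \<open>O(n\<^bsup>1+1/t\<^esup>)\<close> by the Bondy-Simonovits theorem, which is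
  proved by breadth-first search: consecutive layers span few edges, so layers grow by a factor
  proportional to the degree. The odd case reduces to the even one by a random vertex partition.

  Lower bound: in case (ii), \<open>K\<^sub>s \<or> C\<^sub>l\<close> is not \<open>r\<close>-colourable, so a balanced complete \<open>r\<close>-partite
  graph, with a matching added to reach \<open>m\<close> edges exactly, does not contain it.\<close>

section \<open>Graphs as adjacency relations, greedy paths, dense subsets\<close>

text \<open>A graph is a relation together with a vertex set, so that passing to a neighbourhood or
  to a subset changes only the set.\<close>

definition nbh :: "('a \<Rightarrow> 'a \<Rightarrow> bool) \<Rightarrow> 'a set \<Rightarrow> 'a \<Rightarrow> 'a set" where
  "nbh E V v = {u \<in> V. E v u}"

definition arcs :: "('a \<Rightarrow> 'a \<Rightarrow> bool) \<Rightarrow> 'a set \<Rightarrow> ('a \<times> 'a) set" where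
  "arcs E V = {(u, v). u \<in> V \<and> v \<in> V \<and> E u v}"

definition cliques :: "('a \<Rightarrow> 'a \<Rightarrow> bool) \<Rightarrow> 'a set \<Rightarrow> nat \<Rightarrow> 'a set set" where
  "cliques E V q = {S. S \<subseteq> V \<and> card S = q \<and> (\<forall>x\<in>S. \<forall>y\<in>S. x \<noteq> y \<longrightarrow> E x y)}"

definition has_cycle :: "('a \<Rightarrow> 'a \<Rightarrow> bool) \<Rightarrow> 'a set \<Rightarrow> nat \<Rightarrow> bool" where
  "has_cycle E V l \<longleftrightarrow> (\<exists>xs. length xs = l \<and> distinct xs \<and> set xs \<subseteq> V \<and>
     successively E xs \<and> E (last xs) (hd xs))"

lemma finite_nbh [simp]: "finite V \<Longrightarrow> finite (nbh E V v)"
  by (simp add: nbh_def)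

lemma nbh_subset: "nbh E V v \<subseteq> V"
  by (auto simp: nbh_def)

lemma nbh_mono: "W \<subseteq> V \<Longrightarrow> nbh E W v \<subseteq> nbh E V v"
  by (auto simp: nbh_def)

lemma finite_arcs [simp]: "finite V \<Longrightarrow> finite (arcs E V)"
  by (rule finite_subset[of _ "V \<times> V"]) (auto simp: arcs_def)

lemma card_arcs: "finite V \<Longrightarrow> card (arcs E V) = (\<Sum>v\<in>V. card (nbh E V v))"
proof -
  assume "finite V"
  moreover have "arcs E V = Sigma V (nbh E V)"
    by (auto simp: arcs_def nbh_def)
  ultimately show ?thesis by simp
qed

lemma finite_cliques [simp]: "finite V \<Longrightarrow> finite (cliques E V q)"
  by (rule finite_subset[of _ "Pow V"]) (auto simp: cliques_def)

lemma has_cycle_mono: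
  assumes "has_cycle E V l" "V \<subseteq> W" "\<And>u v. u \<in> V \<Longrightarrow> v \<in> V \<Longrightarrow> E u v \<Longrightarrow> E' u v" "l > 0"
  shows "has_cycle E' W l"
proof -
  obtain xs where xs: "length xs = l" "distinct xs" "set xs \<subseteq> V" "successively E xs" 
    "E (last xs) (hd xs)" using assms(1) by (auto simp: has_cycle_def)
  have "successively E' xs"
    by (rule successively_mono[OF xs(4)]) (use xs(3) assms(3) in auto)
  moreover have "xs \<noteq> []" using xs(1) \<open>l > 0\<close> by auto
  moreover have "E' (last xs) (hd xs)"
    using xs(3,5) assms(3) \<open>xs \<noteq> []\<close> by (meson hd_in_set last_in_set subsetD)
  ultimately show ?thesis
    using xs assms(2) unfolding has_cycle_def by (intro exI[of _ xs]) auto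
qed

text \<open>Each vertex left behind joins the forbidden set \<open>F\<close>. While
  \<open>card F\<close> is below \<open>D\<close>, some neighbour of the current end avoids
  \<open>F\<close>, and irreflexivity makes it differ from that end.\<close>

lemma greedy_path:
  assumes "finite W" "irreflp E" "\<And>w. w \<in> W \<Longrightarrow> card (nbh E W w) \<ge> D"
    and "finite F" "x \<in> W - F" "card F + p \<le> D"
  shows "\<exists>xs. length xs = Suc p \<and> hd xs = x \<and> distinct xs \<and> set xs \<subseteq> W - F \<and> successively E xs"
  using assms(4-)
proof (induction p arbitrary: F x)
  case 0
  then show ?case by (intro exI[of _ "[x]"]) auto
next
  case (Suc p)
  have "\<not> nbh E W x \<subseteq> F"
    using card_mono[OF \<open>finite F\<close>, of "nbh E W x"] assms(3)[of x] Suc.prems by fastforce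
  then obtain y where y: "y \<in> W" "E x y" "y \<notin> F" by (auto simp: nbh_def)
  then have "x \<noteq> y" using assms(2) by (auto simp: irreflp_def)
  have "\<exists>xs. length xs = Suc p \<and> hd xs = y \<and> distinct xs \<and> set xs \<subseteq> W - insert x F 
      \<and> successively E xs"
    using Suc.prems y \<open>x \<noteq> y\<close> by (intro Suc.IH) (auto simp: card_insert_if)
  then obtain xs where "length xs = Suc p" "hd xs = y" "distinct xs" "set xs \<subseteq> W - insert x F"
    "successively E xs" by blast
  then show ?case using y Suc.prems
    by (intro exI[of _ "x # xs"]) (auto simp: successively_Cons)
qed

text \<open>Deleting a vertex of degree at most \<open>c\<close> costs at most \<open>2 * c\<close>
  arcs, so the density hypothesis survives each deletion. It fails for the empty set, hence the
  deletions stop earlier.\<close>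

lemma min_degree_subgraph:
  assumes "finite V" "symp E" "card (arcs E V) > 2 * c * card V"
  shows "\<exists>W\<subseteq>V. W \<noteq> {} \<and> (\<forall>w\<in>W. card (nbh E W w) > c)"
  using assms
proof (induction "card V" arbitrary: V rule: less_induct)
  case less
  have "V \<noteq> {}" using less.prems by (auto simp: arcs_def)
  show ?case
  proof (cases "\<forall>w\<in>V. card (nbh E V w) > c")
    case True
    then show ?thesis using \<open>V \<noteq> {}\<close> by blast
  next
    case False
    then obtain v where v: "v \<in> V" "card (nbh E V v) \<le> c" by force
    let ?U = "V - {v}"
    have "arcs E V \<subseteq> arcs E ?U \<union> Pair v ` nbh E V v \<union> (\<lambda>u. (u, v)) ` nbh E V v"
      using sympD[OF less.prems(2)] by (auto simp: arcs_def nbh_def)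
    then have "card (arcs E V) \<le> card (arcs E ?U \<union> Pair v ` nbh E V v \<union> (\<lambda>u. (u, v)) ` nbh E V v)"
      using less.prems(1) by (intro card_mono) auto
    also have "\<dots> \<le> card (arcs E ?U) + card (Pair v ` nbh E V v) + card ((\<lambda>u. (u, v)) ` nbh E V v)"
      by (meson add_mono card_Un_le le_refl order_trans)
    also have "\<dots> \<le> card (arcs E ?U) + c + c"
      using v(2) less.prems(1) by (intro add_mono order_trans[OF card_image_le]) auto
    finally have "card (arcs E V) \<le> card (arcs E ?U) + 2 * c" by simp
    moreover have "card V = Suc (card ?U)"
      using v(1) less.prems(1) by (metis card.remove)
    ultimately have "\<exists>W\<subseteq>?U. W \<noteq> {} \<and> (\<forall>w\<in>W. card (nbh E W w) > c)"
      using less.prems by (intro less.hyps) auto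
    then show ?thesis by blast
  qed
qed

text \<open>Every second vertex lies in \<open>Y\<close> and its two neighbours on the path have
  equal values, so \<open>f\<close> is constant along the positions in \<open>X\<close>. The sets
  \<open>X\<close> and \<open>Y\<close> may coincide, which covers edges inside one layer.\<close>

lemma even_path_end:
  assumes "\<And>u v. E u v \<Longrightarrow> (u \<in> X \<longrightarrow> v \<in> Y) \<and> (u \<in> Y \<longrightarrow> v \<in> X)" "symp E"
    and "\<And>w a b. w \<in> W \<inter> Y \<Longrightarrow> a \<in> nbh E W w \<Longrightarrow> b \<in> nbh E W w \<Longrightarrow> f a = f b"
    and "length p = Suc (2 * n)" "successively E p" "set p \<subseteq> W" "hd p \<in> X"
  shows "last p \<in> X \<and> f (last p) = f (hd p)"
  using assms(4-)
proof (induction n arbitrary: p)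
  case 0
  then show ?case by (cases p) auto
next
  case (Suc n)
  then obtain x y p' where p: "p = x # y # p'" "length p' = Suc (2 * n)"
    by (cases p; cases "tl p") auto
  then have "p' \<noteq> []" by auto
  then have e: "E x y" "E y (hd p')" "successively E p'" "x \<in> W" "y \<in> W" "hd p' \<in> W"
    using Suc.prems p by (auto simp: successively_Cons)
  moreover have "y \<in> Y" "hd p' \<in> X" using e assms(1) Suc.prems(4) p by auto
  moreover have "f x = f (hd p')"
    using assms(3)[of y x "hd p'"] e \<open>y \<in> Y\<close> sympD[OF assms(2)] by (auto simp: nbh_def)
  moreover have "last p' \<in> X \<and> f (last p') = f (hd p')"
    using Suc.prems p e \<open>hd p' \<in> X\<close> by (intro Suc.IH) auto
  ultimately show ?case using p \<open>p' \<noteq> []\<close> by simp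
qed

subsection \<open>Even cycles\<close>

text \<open>Let \<open>j\<close> be maximal such that two neighbours \<open>a, b\<close> of a common vertex \<open>w\<close> can have distinct
  \<open>j\<close>-th ancestors. Start at a third neighbour of \<open>w\<close> and walk an even path, avoiding \<open>w, a, b\<close>,
  to a vertex \<open>e\<close>. All \<open>(j+1)\<close>-st ancestors agree, while \<open>e\<close> differs from one of \<open>a, b\<close> in its
  \<open>j\<close>-th ancestor; the tree paths from \<open>e\<close> and from that vertex close the cycle. The argument
  applies within a layer as well as between consecutive layers, so the host need not be
  bipartite.\<close>

lemma layer_pair_cycle:
  fixes L :: "nat \<Rightarrow> 'a set" and par :: "'a \<Rightarrow> 'a"
  assumes E: "symp E" "irreflp E"
    and LV: "\<And>i. L i \<subseteq> V" and disj: "\<And>i j. i \<noteq> j \<Longrightarrow> L i \<inter> L j = {}" and L0: "L 0 = {x0}"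
    and par: "\<And>i x. x \<in> L (Suc i) \<Longrightarrow> par x \<in> L i \<and> E x (par x)"
    and i: "i < k" and Y: "Y = L i \<or> Y = L (Suc i)"
    and H: "H = (\<lambda>u v. E u v \<and> (u \<in> L i \<and> v \<in> Y \<or> u \<in> Y \<and> v \<in> L i))"
    and W: "finite W" "W \<noteq> {}" "W \<subseteq> V" "\<And>w. w \<in> W \<Longrightarrow> card (nbh H W w) > 2 * k + 2"
  shows "has_cycle E V (2 * k)"
proof -
  let ?X = "L i"
  have symH: "symp H" using E(1) unfolding H symp_def by blast
  have irrH: "irreflp H" using E(2) unfolding H irreflp_def by blast
  have HE: "H u v \<Longrightarrow> E u v" for u v unfolding H by simp
  have HXY: "H u v \<Longrightarrow> (u \<in> ?X \<longrightarrow> v \<in> Y) \<and> (u \<in> Y \<longrightarrow> v \<in> ?X)" for u v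
    using Y disj[of i "Suc i"] unfolding H by auto
  have HXY': "H u v \<Longrightarrow> u \<in> ?X \<union> Y \<and> v \<in> ?X \<union> Y" for u v unfolding H by auto
  have anc: "(par ^^ h) x \<in> L (i - h)" if "x \<in> ?X" "h \<le> i" for x h
    using that(2)
  proof (induction h)
    case (Suc h)
    then have "(par ^^ h) x \<in> L (Suc (i - Suc h))" by (simp add: Suc_diff_Suc)
    then show ?case using par by simp
  qed (use that in simp)
  have anc_edge: "E ((par ^^ h) x) ((par ^^ Suc h) x)" if "x \<in> ?X" "h < i" for x h
  proof -
    have "(par ^^ h) x \<in> L (Suc (i - Suc h))" using anc[OF that(1), of h] that(2)
      by (simp add: Suc_diff_Suc)
    then show ?thesis using par by simp
  qed
  have WYne: "\<exists>w. w \<in> W \<inter> Y"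
  proof -
    obtain w where w: "w \<in> W" using W(2) by auto
    then have "nbh H W w \<noteq> {}" using W(4)[of w] by force
    then obtain u where "u \<in> W" "H w u" by (auto simp: nbh_def)
    then show ?thesis using w HXY[of w u] HXY'[of w u] by blast
  qed
  define P where "P j \<longleftrightarrow> (\<forall>w\<in>W \<inter> Y. \<forall>a\<in>nbh H W w. \<forall>b\<in>nbh H W w. (par ^^ j) a = (par ^^ j) b)" for j
  have nbX: "a \<in> ?X" if "w \<in> W \<inter> Y" "a \<in> nbh H W w" for a w
    using that HXY[of w a] by (auto simp: nbh_def)
  \<comment> \<open>All \<open>i\<close>-th ancestors are the root \<open>x0\<close>, while
    \<open>P 0\<close> would force degree at most 1; so \<open>P\<close> turns from false to true at
    some \<open>j < i\<close>.\<close>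
  have "P i" unfolding P_def using anc[of _ i] nbX L0 by (metis diff_self_eq_0 order_refl singletonD)
  moreover have "\<not> P 0"
  proof
    assume "P 0"
    obtain w where w: "w \<in> W \<inter> Y" using WYne by blast
    have fin: "finite (nbh H W w)" using W(1) by simp
    have "card (nbh H W w) \<le> Suc 0"
      using \<open>P 0\<close> w unfolding P_def by (subst card_le_Suc0_iff_eq[OF fin]) auto
    then show False using W(4)[of w] w by auto
  qed
  ultimately obtain j where j: "P (Suc j)" "\<not> P j" "j < i"
    by (metis ex_least_nat_less less_eq_Suc_le)
  obtain w a b where w: "w \<in> W" "w \<in> Y" "a \<in> nbh H W w" "b \<in> nbh H W w" "(par ^^ j) a \<noteq> (par ^^ j) b"
    using j(2) unfolding P_def by blast
  have "card {w, a, b} \<le> 3" by (simp add: card_insert_if)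
  have "\<not> nbh H W w \<subseteq> {w, a, b}"
    using card_mono[of "{w, a, b}" "nbh H W w"] \<open>card {w, a, b} \<le> 3\<close> W(4)[OF w(1)] i by fastforce
  then obtain z where z: "z \<in> nbh H W w" "z \<notin> {w, a, b}" by blast
  \<comment> \<open>The cycle will consist of \<open>c\<close>, \<open>w\<close>, a path on
    \<open>2 * n + 1\<close> vertices, \<open>j + 1\<close> ancestors of \<open>e\<close> and
    \<open>j\<close> ancestors of \<open>c\<close>; this \<open>n\<close> makes the total
    \<open>2 * k\<close>.\<close>
  define n where "n = k - Suc (Suc j)"
  have n: "k = Suc (Suc j) + n" using j(3) i by (simp add: n_def)
  have "\<exists>p. length p = Suc (2 * n) \<and> hd p = z \<and> distinct p \<and> set p \<subseteq> W - {w, a, b} \<and> successively H p"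
  proof (rule greedy_path[where D = "2 * k + 2"])
    show "card {w, a, b} + 2 * n \<le> 2 * k + 2" using n \<open>card {w, a, b} \<le> 3\<close> by simp
    show "z \<in> W - {w, a, b}" using z by (auto simp: nbh_def)
  qed (use W irrH in \<open>auto intro: less_imp_le\<close>)
  then obtain p where p: "length p = Suc (2 * n)" "hd p = z" "distinct p" "set p \<subseteq> W - {w, a, b}"
    "successively H p" by blast
  have pne: "p \<noteq> []" using p(1) by auto
  define e where "e = last p"
  have zX: "z \<in> ?X" using nbX[of w z] w z by auto
  have e: "e \<in> ?X \<and> (par ^^ Suc j) e = (par ^^ Suc j) z"
    unfolding e_def p(2)[symmetric]
  proof (rule even_path_end[where X = ?X and Y = Y and E = H and W = W])
    show "\<And>w a b. w \<in> W \<inter> Y \<Longrightarrow> a \<in> nbh H W w \<Longrightarrow> b \<in> nbh H W w \<Longrightarrow> (par ^^ Suc j) a = (par ^^ Suc j) b"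
      using j(1) unfolding P_def by blast
    show "hd p \<in> ?X" using p(2) zX by simp
  qed (use HXY symH p in auto)
  obtain c where c: "c \<in> nbh H W w" "c = a \<or> c = b" "(par ^^ j) c \<noteq> (par ^^ j) e"
    using w(3-5) by metis
  have cX: "c \<in> ?X" using nbX[of w c] w c by auto
  \<comment> \<open>\<open>c\<close> and \<open>z\<close> are both neighbours of \<open>w\<close>,
    and \<open>z\<close> agrees with \<open>e\<close> by the even walk.\<close>
  have ce: "(par ^^ Suc j) e = (par ^^ Suc j) c"
    using j(1) c(1) z(1) w(1,2) e unfolding P_def by (metis IntI)
  \<comment> \<open>Equal ancestors stay equal further up, so a meeting at height \<open>h\<close>
    would contradict the choice of \<open>c\<close>.\<close>
  have neq: "(par ^^ h) c \<noteq> (par ^^ h) e" if "h \<le> j" for h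
  proof
    assume "(par ^^ h) c = (par ^^ h) e"
    then have "(par ^^ (j - h)) ((par ^^ h) c) = (par ^^ (j - h)) ((par ^^ h) e)" by simp
    then show False using c(3) that by (simp flip: funpow_add comp_apply[of "par ^^ (j - h)"])
  qed
  define up where "up x h = (par ^^ h) x" for x h
  have upL: "up x h \<in> L (i - h)" if "x \<in> ?X" "h \<le> i" for x h using anc that by (simp add: up_def)
  have upneq: "up x h \<noteq> up y h'" if "x \<in> ?X" "y \<in> ?X" "h \<le> i" "h' \<le> i" "h \<noteq> h'" for x y h h'
  proof -
    have "i - h \<noteq> i - h'" using that by linarith
    then show ?thesis using upL[OF that(1,3)] upL[OF that(2,4)] disj[of "i - h" "i - h'"] by auto
  qed
  have upXY: "up x h \<notin> ?X \<union> Y" if "x \<in> ?X" "0 < h" "h \<le> i" for x h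
  proof -
    have "i - h \<noteq> i" "i - h \<noteq> Suc i" using that by linarith+
    then show ?thesis using upL[OF that(1,3)] disj[of "i - h" i] disj[of "i - h" "Suc i"] Y by auto
  qed
  have up_edge: "E (up x h) (up x (Suc h))" if "x \<in> ?X" "h < i" for x h
    using anc_edge[OF that] by (simp add: up_def)
  have up0 [simp]: "up x 0 = x" for x by (simp add: up_def)
  \<comment> \<open>\<open>A\<close> climbs from \<open>e\<close> to the common ancestor at height
    \<open>j + 1\<close>; \<open>B\<close> descends from there towards \<open>c\<close>, both of its
    ends being left out.\<close>
  define A where "A = map (up e) [1..<Suc (Suc j)]"
  define B where "B = map (up c) (rev [1..<Suc j])"
  let ?xs = "c # w # p @ A @ B"
  have eX: "e \<in> ?X" using e by simp
  have "c \<noteq> w" using c(1) irrH by (auto simp: nbh_def irreflp_def)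
  have "length ?xs = 2 * k" using p(1) n by (simp add: A_def B_def)
  moreover have "distinct ?xs"
  proof -
    \<comment> \<open>Vertices of \<open>W\<close> have positive degree in \<open>H\<close> and so
      lie in the two layers, while by \<open>upXY\<close> the lists \<open>A\<close> and
      \<open>B\<close> lie in earlier layers.\<close>
    have core: "set (c # w # p) \<subseteq> ?X \<union> Y"
    proof -
      have "W' \<in> ?X \<union> Y" if "W' \<in> W" for W'
      proof -
        have "nbh H W W' \<noteq> {}" using W(4)[OF that] by force
        then show ?thesis using HXY' by (auto simp: nbh_def)
      qed
      then show ?thesis using p(4) cX w(2) by auto
    qed
    have inj_up: "inj_on (up y) {..i}" if "y \<in> ?X" for y
      using upneq[OF that that] by (meson atMost_iff inj_onI)
    have dA: "distinct A" unfolding A_def distinct_map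
      using j(3) by (auto intro!: inj_on_subset[OF inj_up[OF eX]] simp del: upt_Suc)
    have dB: "distinct B" unfolding B_def distinct_map
      using j(3) by (auto intro!: inj_on_subset[OF inj_up[OF cX]] simp del: upt_Suc)
    have AB: "set A \<inter> set B = {}"
    proof -
      have "up e h \<noteq> up c h'" if "h \<in> {1..<Suc (Suc j)}" "h' \<in> {1..<Suc j}" for h h'
      proof (cases "h = h'")
        case True
        then show ?thesis using neq[of h] that by (auto simp: up_def)
      next
        case False
        then show ?thesis using upneq[OF eX cX] that j(3) by auto
      qed
      then show ?thesis unfolding A_def B_def by auto
    qed
    have "set A \<inter> (?X \<union> Y) = {}" "set B \<inter> (?X \<union> Y) = {}"
      unfolding A_def B_def using upXY eX cX j(3) by auto
    moreover have "distinct (c # w # p)" using p(3,4) c(2) \<open>c \<noteq> w\<close> by auto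
    ultimately show ?thesis using dA dB AB core by auto
  qed
  moreover have "set ?xs \<subseteq> V"
  proof -
    have "up y h \<in> V" if "y \<in> ?X" "h \<le> i" for y h using upL[OF that] LV by blast
    then have "set A \<subseteq> V" "set B \<subseteq> V"
      unfolding A_def B_def using eX cX j(3) by auto
    then show ?thesis using p(4) w W(3) c(1) by (auto simp: nbh_def)
  qed
  moreover have "successively E ?xs"
  proof -
    have sup: "successively E (map (up x) [m..<Suc h])" if "x \<in> ?X" "h \<le> i" for x m h
      using that(2)
    proof (induction h)
      case (Suc h)
      then show ?case using up_edge[OF that(1), of h]
        by (cases "m \<le> Suc h"; cases "m = Suc h")
          (auto simp: successively_append_iff last_map upt_Suc_append simp del: upt_Suc)
    qed (cases m, auto)
    have "successively E A" unfolding A_def using sup[OF eX, of "Suc j" 1] j(3) by simp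
    moreover have "successively E B"
    proof -
      have "successively (\<lambda>x y. E y x) (map (up c) [1..<Suc j])"
        using sup[OF cX, of j 1] j(3) sympD[OF E(1)] by (auto intro: successively_mono)
      then show ?thesis unfolding B_def rev_map[symmetric] by (simp add: successively_rev)
    qed
    moreover have "successively E p" by (rule successively_mono[OF p(5)]) (use HE in auto)
    moreover have "E w (hd p)" "E c w"
      using z(1) c(1) p(2) HE sympD[OF E(1)] by (auto simp: nbh_def)
    moreover have "E (last p) (hd A)"
      using up_edge[OF eX, of 0] j(3) by (simp add: A_def e_def hd_map del: upt_Suc)
    moreover have "B \<noteq> [] \<Longrightarrow> E (last A) (hd B)"
    proof -
      assume "B \<noteq> []"
      then have "j > 0" by (auto simp: B_def split: if_splits)
      then have "hd B = up c j" by (simp add: B_def hd_map hd_rev)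
      moreover have "last A = up c (Suc j)" using ce by (simp add: A_def up_def)
      ultimately show ?thesis using up_edge[OF cX j(3)] sympD[OF E(1)] by simp
    qed
    moreover have "A \<noteq> []" by (simp add: A_def)
    ultimately show ?thesis using pne
      by (auto simp: successively_Cons successively_append_iff hd_append)
  qed
  moreover have "E (last ?xs) (hd ?xs)"
  \<comment> \<open>For \<open>j = 0\<close> the list \<open>B\<close> is empty and \<open>A\<close>
    consists of the common parent of \<open>e\<close> and \<open>c\<close>.\<close>
  proof (cases "j = 0")
    case True
    then have "last ?xs = up c 1" using ce by (simp add: A_def B_def up_def)
    then show ?thesis using up_edge[OF cX, of 0] j(3) True sympD[OF E(1)] by simp
  next
    case False
    then have "B \<noteq> []" "last B = up c 1" by (auto simp: B_def last_map last_rev hd_upt simp del: upt_Suc)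
    then show ?thesis using up_edge[OF cX, of 0] j(3) sympD[OF E(1)] by simp
  qed
  ultimately show ?thesis unfolding has_cycle_def by blast
qed

text \<open>An excess of arcs would leave, by \<open>min_degree_subgraph\<close>, a nonempty set of
  minimum degree above \<open>2 * k + 2\<close>, in which \<open>layer_pair_cycle\<close> finds the
  cycle.\<close>

lemma layer_pair_bound:
  fixes L :: "nat \<Rightarrow> 'a set" and par :: "'a \<Rightarrow> 'a"
  assumes E: "symp E" "irreflp E" and V: "finite V" "\<not> has_cycle E V (2 * k)"
    and LV: "\<And>i. L i \<subseteq> V" and disj: "\<And>i j. i \<noteq> j \<Longrightarrow> L i \<inter> L j = {}" and L0: "L 0 = {x0}"
    and par: "\<And>i x. x \<in> L (Suc i) \<Longrightarrow> par x \<in> L i \<and> E x (par x)"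
    and i: "i < k" and Y: "Y = L i \<or> Y = L (Suc i)"
  defines "H \<equiv> (\<lambda>u v. E u v \<and> (u \<in> L i \<and> v \<in> Y \<or> u \<in> Y \<and> v \<in> L i))"
  shows "card (arcs H (L i \<union> Y)) \<le> 2 * (2 * k + 2) * card (L i \<union> Y)"
proof (rule ccontr)
  assume "\<not> ?thesis"
  moreover have "L i \<union> Y \<subseteq> V" using LV Y by blast
  moreover have "symp H" using E(1) unfolding H_def symp_def by blast
  ultimately obtain W where "W \<subseteq> L i \<union> Y" "W \<noteq> {}" "\<forall>w\<in>W. card (nbh H W w) > 2 * k + 2"
    using min_degree_subgraph[of "L i \<union> Y" H "2 * k + 2"] V(1) finite_subset by (metis not_le)
  then show False
    using layer_pair_cycle[OF E LV disj L0 par i Y H_def[THEN meta_eq_to_obj_eq], of W] V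
      \<open>L i \<union> Y \<subseteq> V\<close> by (meson finite_subset order_trans)
qed

section \<open>Breadth-first layers and their growth\<close>

primrec bfs_ball :: "('a \<Rightarrow> 'a \<Rightarrow> bool) \<Rightarrow> 'a set \<Rightarrow> 'a \<Rightarrow> nat \<Rightarrow> 'a set" where
  "bfs_ball E V x 0 = {x}"
| "bfs_ball E V x (Suc i) = bfs_ball E V x i \<union> {u \<in> V. \<exists>y\<in>bfs_ball E V x i. E y u}"

definition bfs_layer :: "('a \<Rightarrow> 'a \<Rightarrow> bool) \<Rightarrow> 'a set \<Rightarrow> 'a \<Rightarrow> nat \<Rightarrow> 'a set" where
  "bfs_layer E V x i = bfs_ball E V x i - (\<Union>h<i. bfs_ball E V x h)"

lemma bfs_ball_subset: "x \<in> V \<Longrightarrow> bfs_ball E V x i \<subseteq> V"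
  by (induction i) auto

lemma bfs_layer_disjoint: "i \<noteq> j \<Longrightarrow> bfs_layer E V x i \<inter> bfs_layer E V x j = {}"
  by (cases "i < j") (auto simp: bfs_layer_def)

lemma bfs_layer_parent:
  assumes "symp E" "y \<in> bfs_layer E V x (Suc i)"
  shows "\<exists>p\<in>bfs_layer E V x i. E y p"
proof -
  have y: "y \<in> bfs_ball E V x (Suc i)" "\<And>h. h \<le> i \<Longrightarrow> y \<notin> bfs_ball E V x h"
    using assms(2) by (auto simp: bfs_layer_def)
  then obtain p where p: "p \<in> bfs_ball E V x i" "E p y" "y \<in> V" by auto
  have "p \<notin> bfs_ball E V x h" if "h < i" for h
    using y(2)[of "Suc h"] p that by auto
  then show ?thesis using p sympD[OF assms(1)] by (auto simp: bfs_layer_def)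
qed

text \<open>An edge changes the distance from \<open>x\<close> by at most one. At
  \<open>i = 0\<close> the truncated \<open>i - 1\<close> just repeats layer 0.\<close>

lemma bfs_layer_nbh:
  assumes "symp E" "x \<in> V" "y \<in> bfs_layer E V x i" "u \<in> V" "E y u"
  shows "u \<in> bfs_layer E V x (i - 1) \<union> bfs_layer E V x i \<union> bfs_layer E V x (Suc i)"
proof -
  have y: "y \<in> bfs_ball E V x i" "\<And>h. h < i \<Longrightarrow> y \<notin> bfs_ball E V x h" "y \<in> V"
    using assms(2,3) bfs_ball_subset[of x V E i] by (auto simp: bfs_layer_def)
  have "u \<in> bfs_ball E V x (Suc i)" using y assms by auto
  define j where "j = (LEAST j. u \<in> bfs_ball E V x j)"
  have j: "u \<in> bfs_ball E V x j" "j \<le> Suc i"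
    unfolding j_def using \<open>u \<in> bfs_ball E V x (Suc i)\<close> by (rule LeastI, rule Least_le)
  then have uj: "u \<in> bfs_layer E V x j"
    using not_less_Least unfolding bfs_layer_def j_def by blast
  have "y \<in> bfs_ball E V x (Suc j)" using j y sympD[OF assms(1,5)] by auto
  then have "i \<le> Suc j" using y(2) by (meson not_le)
  then have "j = i - 1 \<or> j = i \<or> j = Suc i" using j(2) by linarith
  then show ?thesis using uj by auto
qed

text \<open>By \<open>layer_pair_bound\<close>, single and consecutive layers span only linearly
  many arcs, so large degrees make the layers grow by a factor \<open>q\<close> up to layer
  \<open>k\<close>.\<close>

lemma even_cycle_min_degree:
  fixes E :: "'a \<Rightarrow> 'a \<Rightarrow> bool"
  assumes E: "symp E" "irreflp E" and V: "finite V" "V \<noteq> {}" "\<not> has_cycle E V (2 * k)"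
    and deg: "\<And>v. v \<in> V \<Longrightarrow> card (nbh E V v) \<ge> 2 * (2 * k + 2) * (q + 5)" and q: "q \<ge> 1"
  shows "q ^ k \<le> card V"
proof -
  obtain x where x: "x \<in> V" using V(2) by blast
  let ?L = "bfs_layer E V x"
  let ?c = "2 * (2 * k + 2)"
  have LV: "?L i \<subseteq> V" for i using bfs_ball_subset[OF x] by (auto simp: bfs_layer_def)
  have finL: "finite (?L i)" for i using LV V(1) finite_subset by blast
  have L0: "?L 0 = {x}" by (simp add: bfs_layer_def)
  \<comment> \<open>The layer index is quantified inside the choice, so that one function serves all
    layers; disjointness recovers the index.\<close>
  define par where "par y = (SOME p. E y p \<and> (\<exists>i. y \<in> ?L (Suc i) \<and> p \<in> ?L i))" for y
  have par: "par y \<in> ?L i \<and> E y (par y)" if y: "y \<in> ?L (Suc i)" for y i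
  proof -
    have "\<exists>p. E y p \<and> (\<exists>i. y \<in> ?L (Suc i) \<and> p \<in> ?L i)"
      using bfs_layer_parent[OF E(1) y] y by blast
    from someI_ex[OF this] have "E y (par y)" "\<exists>j. y \<in> ?L (Suc j) \<and> par y \<in> ?L j"
      unfolding par_def by auto
    then show ?thesis using y bfs_layer_disjoint[of "Suc i" _ E V x] by (metis IntI Suc_inject empty_iff)
  qed
  have pair: "card {(u, v). u \<in> ?L i \<and> v \<in> Y \<and> E u v} \<le> ?c * (card (?L i) + card Y)
      \<and> card {(u, v). u \<in> Y \<and> v \<in> ?L i \<and> E u v} \<le> ?c * (card (?L i) + card Y)"
    if i: "i < k" and Y: "Y = ?L i \<or> Y = ?L (Suc i)" for i Y
  proof -
    define H where "H = (\<lambda>u v. E u v \<and> (u \<in> ?L i \<and> v \<in> Y \<or> u \<in> Y \<and> v \<in> ?L i))"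
    have fin: "finite (?L i \<union> Y)" using Y finL by auto
    have "card (arcs H (?L i \<union> Y)) \<le> ?c * card (?L i \<union> Y)"
      unfolding H_def using layer_pair_bound[OF E V(1,3) LV bfs_layer_disjoint L0 par i Y] by simp
    also have "\<dots> \<le> ?c * (card (?L i) + card Y)" by (intro mult_left_mono card_Un_le) simp
    finally have "card (arcs H (?L i \<union> Y)) \<le> ?c * (card (?L i) + card Y)" .
    moreover have "card {(u, v). u \<in> ?L i \<and> v \<in> Y \<and> E u v} \<le> card (arcs H (?L i \<union> Y))"
      "card {(u, v). u \<in> Y \<and> v \<in> ?L i \<and> E u v} \<le> card (arcs H (?L i \<union> Y))"
      using fin by (intro card_mono finite_arcs; force simp: arcs_def H_def)+
    ultimately show ?thesis by linarith
  qed
  \<comment> \<open>The second inequality is carried along because it bounds the arcs back to the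
    previous layer in the next step.\<close>
  have step: "q * card (?L i) \<le> card (?L (Suc i)) \<and> card (?L i) \<le> card (?L (Suc i))" if "i < k" for i
    using that
  proof (induction i)
    case (Suc i)
    then have le: "card (?L i) \<le> card (?L (Suc i))" by simp
    let ?Q = "?L (Suc i)"
    let ?A = "\<lambda>Y. {(u, v). u \<in> ?Q \<and> v \<in> Y \<and> E u v}"
    have finA: "finite (?A (?L j))" for j
      by (rule finite_subset[of _ "?Q \<times> ?L j"]) (use finL in auto)
    have b1: "card (?A (?L i)) \<le> ?c * (card (?L i) + card ?Q)" using pair[of i ?Q] Suc.prems by simp
    have b2: "card (?A ?Q) \<le> ?c * (card ?Q + card ?Q)" using pair[of "Suc i" ?Q] Suc.prems by simp
    have b3: "card (?A (?L (Suc (Suc i)))) \<le> ?c * (card ?Q + card (?L (Suc (Suc i))))"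
      using pair[of "Suc i" "?L (Suc (Suc i))"] Suc.prems by simp
    \<comment> \<open>The degree sum of layer \<open>i + 1\<close> is split by the layer of the
      other end. Up to the factor \<open>?c\<close>, the three bounds amount to at most
      \<open>5 * card ?Q\<close> plus the size of the next layer, hence the summand 5 in the degree
      condition.\<close>
    have "?c * (q + 5) * card ?Q = (\<Sum>v\<in>?Q. ?c * (q + 5))" by simp
    also have "\<dots> \<le> (\<Sum>v\<in>?Q. card (nbh E V v))" by (rule sum_mono) (use deg LV in blast)
    also have "\<dots> = card (Sigma ?Q (nbh E V))" using finL V(1) by simp
    also have "\<dots> \<le> card (?A (?L i) \<union> ?A ?Q \<union> ?A (?L (Suc (Suc i))))"
    proof (rule card_mono)
      show "Sigma ?Q (nbh E V) \<subseteq> ?A (?L i) \<union> ?A ?Q \<union> ?A (?L (Suc (Suc i)))"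
        using bfs_layer_nbh[OF E(1) x, of _ "Suc i"] by (fastforce simp: nbh_def)
    qed (use finA in blast)
    also have "\<dots> \<le> card (?A (?L i)) + card (?A ?Q) + card (?A (?L (Suc (Suc i))))"
      by (meson add_mono card_Un_le le_refl order_trans)
    also have "\<dots> \<le> ?c * (card (?L i) + card ?Q) + ?c * (card ?Q + card ?Q)
        + ?c * (card ?Q + card (?L (Suc (Suc i))))"
      using b1 b2 b3 by linarith
    also have "\<dots> = ?c * (card (?L i) + 4 * card ?Q + card (?L (Suc (Suc i))))"
      by (simp add: algebra_simps)
    finally have "?c * ((q + 5) * card ?Q) \<le> ?c * (card (?L i) + 4 * card ?Q + card (?L (Suc (Suc i))))"
      by (simp only: mult.assoc)
    then have "(q + 5) * card ?Q \<le> card (?L i) + 4 * card ?Q + card (?L (Suc (Suc i)))"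
      by (subst (asm) mult_le_cancel1) simp
    then have "q * card ?Q \<le> card (?L (Suc (Suc i)))" using le by (simp add: algebra_simps)
    moreover have "card ?Q \<le> q * card ?Q" using q by simp
    ultimately show ?case by linarith
  next
    case 0
    have "nbh E V x \<subseteq> ?L 1"
      using E(2) by (auto simp: nbh_def bfs_layer_def irreflp_def)
    then have "card (nbh E V x) \<le> card (?L 1)" by (intro card_mono finL)
    moreover have "q \<le> ?c * (q + 5)" by simp
    ultimately show ?case using deg[OF x] q L0 by simp
  qed
  have "q ^ i \<le> card (?L i)" if "i \<le> k" for i
    using that
  proof (induction i)
    case (Suc i)
    then have "q * q ^ i \<le> q * card (?L i)" by simp
    also have "\<dots> \<le> card (?L (Suc i))" using step[of i] Suc.prems by simp
    finally show ?case by simp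
  qed (simp add: L0)
  also have "card (?L k) \<le> card V" using LV V(1) by (intro card_mono)
  finally show ?thesis by simp
qed

text \<open>A higher density would leave a subset of large minimum degree, which by
  \<open>even_cycle_min_degree\<close> has at least \<open>q ^ k\<close> vertices, more than there
  are.\<close>

theorem even_cycle_arcs:
  fixes E :: "'a \<Rightarrow> 'a \<Rightarrow> bool"
  assumes E: "symp E" "irreflp E" and V: "finite V" "\<not> has_cycle E V (2 * k)" and k: "k \<ge> 1"
  shows "real (card (arcs E V)) \<le> real (28 * (2 * k + 2)) * real (card V) powr (1 + 1 / real k)"
proof (cases "V = {}")
  case True
  then show ?thesis by (simp add: arcs_def)
next
  case False
  define n where "n = card V"
  have n: "n \<ge> 1" using False V(1) by (simp add: n_def Suc_le_eq card_gt_0_iff)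
  define y where "y = real n powr (1 / real k)"
  have y1: "y \<ge> 1" unfolding y_def using n by (intro ge_one_powr_ge_zero) auto
  have yk: "y ^ k = real n"
    unfolding y_def using n k by (simp add: powr_powr flip: powr_realpow)
  \<comment> \<open>Just above the \<open>k\<close>-th root \<open>y\<close> of \<open>n\<close>, so
    that \<open>q ^ k > n\<close>; also \<open>q + 5 \<le> 7 * y\<close>, which turns the factor 4
    into 28.\<close>
  define q where "q = nat \<lfloor>y\<rfloor> + 1"
  have q: "y < real q" "real q \<le> y + 1" unfolding q_def using y1 by linarith+
  have "real n < real q ^ k"
    using power_strict_mono[OF q(1), of k] y1 k yk by simp
  then have nq: "n < q ^ k" by (metis of_nat_less_iff of_nat_power)
  have "card (arcs E V) \<le> 2 * (2 * (2 * k + 2) * (q + 5)) * n"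
  proof (rule ccontr)
    assume "\<not> ?thesis"
    then obtain W where W: "W \<subseteq> V" "W \<noteq> {}" "\<forall>w\<in>W. card (nbh E W w) > 2 * (2 * k + 2) * (q + 5)"
      using min_degree_subgraph[OF V(1) E(1), of "2 * (2 * k + 2) * (q + 5)"] by (auto simp: n_def)
    have "\<not> has_cycle E W (2 * k)" using has_cycle_mono[of E W "2 * k" V E] V(2) W(1) k by auto
    then have "q ^ k \<le> card W"
      using W V(1) finite_subset[OF W(1) V(1)]
      by (intro even_cycle_min_degree[OF E]) (auto intro: less_imp_le simp: q_def)
    also have "\<dots> \<le> n" unfolding n_def using W(1) V(1) by (rule card_mono[rotated])
    finally show False using nq by simp
  qed
  then have "real (card (arcs E V)) \<le> real (2 * (2 * (2 * k + 2) * (q + 5)) * n)"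
    by (simp only: of_nat_le_iff)
  also have "\<dots> = real (4 * (2 * k + 2)) * (real q + 5) * real n" by (simp add: algebra_simps)
  also have "\<dots> \<le> real (4 * (2 * k + 2)) * (7 * y) * real n"
    using q y1 by (intro mult_right_mono mult_left_mono) auto
  also have "\<dots> = real (28 * (2 * k + 2)) * (real n powr 1 * y)" using n by simp
  also have "real n powr 1 * y = real n powr (1 + 1 / real k)" unfolding y_def by (simp add: powr_add)
  finally show ?thesis by (simp add: n_def)
qed

section \<open>Edges in triangles when an odd cycle is forbidden\<close>

text \<open>Prescribing the membership of three distinct vertices leaves one subset in eight; this
  is the probability for the random partition.\<close>

lemma card_subsets_separating:
  assumes "finite V" "u \<in> V" "v \<in> V" "w \<in> V" "u \<noteq> v" "w \<noteq> u" "w \<noteq> v"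
  shows "8 * card {A \<in> Pow V. u \<in> A \<and> v \<in> A \<and> w \<notin> A} = 2 ^ card V"
proof -
  have "bij_betw (\<lambda>A. A \<union> {u, v}) (Pow (V - {u, v, w})) {A \<in> Pow V. u \<in> A \<and> v \<in> A \<and> w \<notin> A}"
    by (rule bij_betw_byWitness[where f' = "\<lambda>A. A - {u, v}"]) (use assms in auto)
  then have "card {A \<in> Pow V. u \<in> A \<and> v \<in> A \<and> w \<notin> A} = card (Pow (V - {u, v, w}))"
    by (rule bij_betw_same_card[symmetric])
  also have "\<dots> = 2 ^ (card V - 3)"
    using assms by (subst card_Pow) (auto simp: card_Diff_subset)
  finally have *: "card {A \<in> Pow V. u \<in> A \<and> v \<in> A \<and> w \<notin> A} = 2 ^ (card V - 3)" .
  have "card {u, v, w} \<le> card V" using assms by (intro card_mono) auto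
  then have "card V = (card V - 3) + 3" using assms by auto
  then have "(2::nat) ^ card V = 2 ^ (card V - 3) * 2 ^ 3" by (metis power_add)
  with * show ?thesis by simp
qed

text \<open>Excluding an odd cycle does not make a graph sparse, as complete bipartite graphs show,
  but it does so for the edges in triangles, and these carry all cliques on at least three
  vertices.\<close>

definition triangle_edge :: "('a \<Rightarrow> 'a \<Rightarrow> bool) \<Rightarrow> 'a set \<Rightarrow> 'a \<Rightarrow> 'a \<Rightarrow> bool" where
  "triangle_edge E V u v \<longleftrightarrow> E u v \<and> (\<exists>w\<in>V. E u w \<and> E v w)"

lemma triangle_edge_simple:
  assumes "symp E" "irreflp E"
  shows "symp (triangle_edge E V)" "irreflp (triangle_edge E V)"
  using assms by (auto simp: triangle_edge_def symp_def irreflp_def)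

text \<open>For any vertex set \<open>A\<close>, the edges inside \<open>A\<close> that have a common neighbour outside \<open>A\<close> form
  a \<open>C\<^bsub>2k\<^esub>\<close>-free graph, as a cycle could be prolonged through such a neighbour. A random \<open>A\<close> catches
  each edge in a triangle with probability at least \<open>1/8\<close>.\<close>

lemma odd_cycle_triangle_arcs:
  fixes E :: "'a \<Rightarrow> 'a \<Rightarrow> bool"
  assumes E: "symp E" "irreflp E" and V: "finite V" "\<not> has_cycle E V (2 * k + 1)" and k: "k \<ge> 1"
  shows "real (card (arcs (triangle_edge E V) V))
    \<le> 8 * real (28 * (2 * k + 2)) * real (card V) powr (1 + 1 / real k)"
proof -
  let ?T = "arcs (triangle_edge E V) V"
  let ?B = "real (28 * (2 * k + 2)) * real (card V) powr (1 + 1 / real k)"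
  \<comment> \<open>One common neighbour is fixed per arc, so that \<open>good A a\<close>
    prescribes three memberships and holds for exactly one eighth of the sets
    \<open>A\<close>.\<close>
  define apex where "apex = (\<lambda>(u, v). SOME w. w \<in> V \<and> E u w \<and> E v w)"
  have apex: "apex (u, v) \<in> V \<and> E u (apex (u, v)) \<and> E v (apex (u, v))" if "(u, v) \<in> ?T" for u v
  proof -
    have "\<exists>w. w \<in> V \<and> E u w \<and> E v w" using that by (auto simp: arcs_def triangle_edge_def)
    from someI_ex[OF this] show ?thesis by (simp add: apex_def)
  qed
  define good where "good A a \<longleftrightarrow> fst a \<in> A \<and> snd a \<in> A \<and> apex a \<notin> A" for A a
  have bound: "real (card {a \<in> ?T. good A a}) \<le> ?B" if A: "A \<subseteq> V" for A
  proof -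
    let ?F = "\<lambda>u v. E u v \<and> (\<exists>w\<in>V - A. E u w \<and> E v w)"
    have no: "\<not> has_cycle ?F A (2 * k)"
    proof
      assume "has_cycle ?F A (2 * k)"
      then obtain xs where xs: "length xs = 2 * k" "distinct xs" "set xs \<subseteq> A"
        "successively ?F xs" "?F (last xs) (hd xs)" unfolding has_cycle_def by blast
      \<comment> \<open>Only the closing edge is rerouted through its common neighbour
        \<open>w\<close>; lying outside \<open>A\<close>, it is a new vertex and raises the length
        to \<open>2 * k + 1\<close>.\<close>
      then obtain w where w: "w \<in> V - A" "E (last xs) w" "E (hd xs) w" by blast
      have "successively E xs" by (rule successively_mono[OF xs(4)]) auto
      then have "has_cycle E V (2 * k + 1)"
        unfolding has_cycle_def using xs w k A sympD[OF E(1)]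
        by (intro exI[of _ "w # xs"]) (auto simp: successively_Cons)
      then show False using V(2) by blast
    qed
    have finA: "finite A" using A V(1) finite_subset by blast
    have "{a \<in> ?T. good A a} \<subseteq> arcs ?F A"
    proof
      fix a assume "a \<in> {a \<in> ?T. good A a}"
      then obtain u v where a: "a = (u, v)" "(u, v) \<in> ?T" "good A (u, v)" by (cases a) auto
      then show "a \<in> arcs ?F A"
        using apex[OF a(2)] by (auto simp: arcs_def triangle_edge_def good_def)
    qed
    then have "card {a \<in> ?T. good A a} \<le> card (arcs ?F A)"
      using finA by (intro card_mono) auto
    then have "real (card {a \<in> ?T. good A a}) \<le> real (card (arcs ?F A))" by simp
    also have "\<dots> \<le> real (28 * (2 * k + 2)) * real (card A) powr (1 + 1 / real k)"
      by (rule even_cycle_arcs[OF _ _ finA no k]) (use E in \<open>auto simp: symp_def irreflp_def\<close>)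
    also have "\<dots> \<le> ?B"
      using A V(1) by (intro mult_left_mono powr_mono2) (auto intro: card_mono)
    finally show ?thesis .
  qed
  have finT: "finite ?T" using V(1) by simp
  \<comment> \<open>Pairs of an arc and a set that is good for it are counted in two ways.\<close>
  have "2 ^ card V * card ?T = (\<Sum>a\<in>?T. 2 ^ card V)" by simp
  also have "\<dots> = (\<Sum>a\<in>?T. 8 * card {A \<in> Pow V. good A a})"
  proof (rule sum.cong[OF refl])
    fix a assume "a \<in> ?T"
    then obtain u v where a: "a = (u, v)" "(u, v) \<in> ?T" by (cases a) auto
    have "u \<noteq> v" "apex a \<noteq> u" "apex a \<noteq> v"
      using a apex[OF a(2)] E(2) by (auto simp: arcs_def triangle_edge_def irreflp_def)
    then show "2 ^ card V = 8 * card {A \<in> Pow V. good A a}"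
      using card_subsets_separating[OF V(1), of u v "apex a"] a apex[OF a(2)]
      by (simp add: good_def arcs_def)
  qed
  also have "\<dots> = 8 * (\<Sum>a\<in>?T. card {A \<in> Pow V. good A a})" by (simp add: sum_distrib_left)
  also have "(\<Sum>a\<in>?T. card {A \<in> Pow V. good A a}) = (\<Sum>A\<in>Pow V. card {a \<in> ?T. good A a})"
    using sum_multicount_gen[of ?T "Pow V" "\<lambda>a A. good A a" "\<lambda>A. card {a \<in> ?T. good A a}"]
      finT V(1) by auto
  finally have "real (2 ^ card V * card ?T) = 8 * (\<Sum>A\<in>Pow V. real (card {a \<in> ?T. good A a}))"
    by simp
  also have "\<dots> \<le> 8 * (\<Sum>A\<in>Pow V. ?B)" by (intro mult_left_mono sum_mono bound) auto
  also have "\<dots> = 2 ^ card V * (8 * ?B)" using V(1) by (simp add: card_Pow)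
  finally have "2 ^ card V * real (card ?T) \<le> 2 ^ card V * (8 * ?B)" by simp
  then have "real (card ?T) \<le> 8 * ?B" by simp
  then show ?thesis by (simp only: mult.assoc)
qed

subsection \<open>Counting cliques\<close>

text \<open>The sets \<open>M v\<close> are left open because two choices occur: the whole
  neighbourhood, and the neighbours of at least the same degree.\<close>

lemma card_cliques_le_sum:
  assumes V: "finite V" and M: "\<And>v. v \<in> V \<Longrightarrow> M v \<subseteq> V"
    and cover: "\<And>S. S \<in> cliques E V (Suc q) \<Longrightarrow> \<exists>v\<in>S. S - {v} \<subseteq> M v"
  shows "card (cliques E V (Suc q)) \<le> (\<Sum>v\<in>V. card (cliques E (M v) q))"
proof -
  have fin: "finite (cliques E (M v) q)" if "v \<in> V" for v
    using M[OF that] V by (meson finite_cliques finite_subset)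
  have "cliques E V (Suc q) \<subseteq> (\<Union>v\<in>V. insert v ` cliques E (M v) q)"
  proof
    fix S assume S: "S \<in> cliques E V (Suc q)"
    then obtain v where v: "v \<in> S" "S - {v} \<subseteq> M v" using cover by blast
    have "S - {v} \<in> cliques E (M v) q" "v \<in> V" using S v by (auto simp: cliques_def)
    moreover have "S = insert v (S - {v})" using v by auto
    ultimately show "S \<in> (\<Union>v\<in>V. insert v ` cliques E (M v) q)" by blast
  qed
  then have "card (cliques E V (Suc q)) \<le> card (\<Union>v\<in>V. insert v ` cliques E (M v) q)"
    using V fin by (intro card_mono) auto
  also have "\<dots> \<le> (\<Sum>v\<in>V. card (insert v ` cliques E (M v) q))" by (rule card_UN_le[OF V])
  also have "\<dots> \<le> (\<Sum>v\<in>V. card (cliques E (M v) q))"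
    using fin by (intro sum_mono card_image_le)
  finally show ?thesis .
qed

lemma card_cliques_le_sum_nbh:
  assumes "finite V"
  shows "card (cliques E V (Suc q)) \<le> (\<Sum>v\<in>V. card (cliques E (nbh E V v) q))"
proof (rule card_cliques_le_sum[OF assms nbh_subset])
  fix S assume S: "S \<in> cliques E V (Suc q)"
  then obtain v where "v \<in> S" by (force simp: cliques_def)
  with S show "\<exists>v\<in>S. S - {v} \<subseteq> nbh E V v"
    by (intro bexI[of _ v]) (auto simp: cliques_def nbh_def)
qed

text \<open>Remove a vertex of degree at most \<open>D\<close>: the cliques through it correspond to
  subsets of its neighbourhood, at most \<open>2 ^ D\<close> of them.\<close>

lemma degenerate_cliques:
  assumes "finite U" and deg: "\<And>W. W \<subseteq> U \<Longrightarrow> W \<noteq> {} \<Longrightarrow> \<exists>w\<in>W. card (nbh E W w) \<le> D"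
    and q: "q \<ge> 1"
  shows "card (cliques E U q) \<le> 2 ^ D * card U"
  using assms(1) deg
proof (induction "card U" arbitrary: U rule: less_induct)
  case less
  show ?case
  proof (cases "U = {}")
    case True
    then show ?thesis using q by (auto simp: cliques_def)
  next
    case False
    then obtain w where w: "w \<in> U" "card (nbh E U w) \<le> D" using less.prems(2)[of U] by blast
    let ?U = "U - {w}"
    have "cliques E U q \<subseteq> cliques E ?U q \<union> insert w ` Pow (nbh E U w)"
    proof
      fix S assume S: "S \<in> cliques E U q"
      show "S \<in> cliques E ?U q \<union> insert w ` Pow (nbh E U w)"
      proof (cases "w \<in> S")
        case True
        then have "S - {w} \<in> Pow (nbh E U w)" "S = insert w (S - {w})"
          using S by (auto simp: cliques_def nbh_def)
        then show ?thesis by blast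
      next
        case False
        then show ?thesis using S by (auto simp: cliques_def)
      qed
    qed
    then have "card (cliques E U q) \<le> card (cliques E ?U q \<union> insert w ` Pow (nbh E U w))"
      using less.prems(1) by (intro card_mono) auto
    also have "\<dots> \<le> card (cliques E ?U q) + card (insert w ` Pow (nbh E U w))" by (rule card_Un_le)
    also have "card (insert w ` Pow (nbh E U w)) \<le> 2 ^ D"
    proof -
      have "card (insert w ` Pow (nbh E U w)) \<le> card (Pow (nbh E U w))"
        using less.prems(1) by (intro card_image_le) auto
      also have "\<dots> \<le> 2 ^ D" using less.prems(1) w(2) by (simp add: card_Pow)
      finally show ?thesis .
    qed
    also have "card (cliques E ?U q) \<le> 2 ^ D * card ?U"
    proof (rule less.hyps)
      show "card ?U < card U" using less.prems(1) w(1) by (rule card_Diff1_less)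
      show "\<exists>w\<in>W. card (nbh E W w) \<le> D" if "W \<subseteq> ?U" "W \<noteq> {}" for W
        using less.prems(2)[of W] that by blast
    qed (use less.prems(1) in simp)
    finally show ?thesis unfolding card.remove[OF less.prems(1) w(1)] by (simp add: algebra_simps)
  qed
qed

text \<open>A path on \<open>l - 1\<close> vertices in the neighbourhood of \<open>v\<close> closes
  through \<open>v\<close> to a cycle of length \<open>l\<close>. A subset of minimum degree
  \<open>l\<close> would contain such a path by \<open>greedy_path\<close>, so the neighbourhood is
  degenerate.\<close>

lemma cycle_free_nbh_cliques:
  assumes E: "symp E" "irreflp E" and V: "finite V" "\<not> has_cycle E V l" and l: "l \<ge> 2"
    and v: "v \<in> V" and q: "q \<ge> 1"
  shows "card (cliques E (nbh E V v) q) \<le> 2 ^ l * card (nbh E V v)"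
proof (rule degenerate_cliques[OF _ _ q])
  show "finite (nbh E V v)" using V by simp
  fix W assume W: "W \<subseteq> nbh E V v" "W \<noteq> {}"
  have finW: "finite W" using W V by (meson finite_nbh finite_subset)
  show "\<exists>w\<in>W. card (nbh E W w) \<le> l"
  proof (rule ccontr)
    assume "\<not> ?thesis"
    then have big: "\<And>w. w \<in> W \<Longrightarrow> card (nbh E W w) \<ge> l" by force
    obtain x where "x \<in> W" using W by blast
    then obtain xs where xs: "length xs = Suc (l - 2)" "distinct xs" "set xs \<subseteq> W" "successively E xs"
      using greedy_path[OF finW E(2) big, of "{}" x "l - 2"] by auto
    have ne: "xs \<noteq> []" using xs by auto
    have adj: "E v y" "E y v" "y \<noteq> v" "y \<in> V" if "y \<in> set xs" for y
    proof -
      have "y \<in> nbh E V v" using xs(3) W(1) that by blast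
      then show "E v y" "E y v" "y \<noteq> v" "y \<in> V" using E
        by (auto simp: nbh_def symp_def irreflp_def)
    qed
    have "has_cycle E V l" unfolding has_cycle_def
      using xs l v ne adj by (intro exI[of _ "v # xs"]) (auto simp: successively_Cons)
    then show False using V(2) by blast
  qed
qed

lemma cycle_free_cliques:
  assumes E: "symp E" "irreflp E" and V: "finite V" "\<not> has_cycle E V l" and l: "l \<ge> 2"
    and r: "r \<ge> 2"
  shows "card (cliques E V r) \<le> 2 ^ l * card (arcs E V)"
proof -
  obtain q where q: "r = Suc q" "q \<ge> 1" using r by (cases r) auto
  have "card (cliques E V r) \<le> (\<Sum>v\<in>V. card (cliques E (nbh E V v) q))"
    unfolding q(1) by (rule card_cliques_le_sum_nbh[OF V(1)])
  also have "\<dots> \<le> (\<Sum>v\<in>V. 2 ^ l * card (nbh E V v))"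
    by (intro sum_mono cycle_free_nbh_cliques[OF E V l _ q(2)])
  also have "\<dots> = 2 ^ l * card (arcs E V)" using V(1) by (simp add: card_arcs sum_distrib_left)
  finally show ?thesis .
qed

lemma cliques_triangle_edge:
  assumes "r \<ge> 3" shows "cliques E V r \<subseteq> cliques (triangle_edge E V) V r"
proof
  fix S assume S: "S \<in> cliques E V r"
  have "triangle_edge E V x y" if "x \<in> S" "y \<in> S" "x \<noteq> y" for x y
  proof -
    have "\<not> S \<subseteq> {x, y}"
      using card_mono[of "{x, y}" S] S assms that by (auto simp: cliques_def)
    then obtain z where z: "z \<in> S" "z \<noteq> x" "z \<noteq> y" by blast
    have "E x y" "E x z" "E y z" "z \<in> V" using S that z by (auto simp: cliques_def)
    then show ?thesis by (auto simp: triangle_edge_def)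
  qed
  then show "S \<in> cliques (triangle_edge E V) V r" using S by (auto simp: cliques_def)
qed

text \<open>The factor from degeneracy times the arc bound of the odd case, with \<open>t\<close>
  enlarged to \<open>l\<close> so that one constant serves both parities.\<close>

definition clique_const :: "nat \<Rightarrow> real" where
  "clique_const l = 2 ^ l * (8 * real (28 * (2 * l + 2)))"

lemma cycle_free_cliques_powr:
  fixes E :: "'a \<Rightarrow> 'a \<Rightarrow> bool"
  assumes E: "symp E" "irreflp E" and V: "finite V" "\<not> has_cycle E V l"
    and t: "t \<ge> 2" and lr: "l = 2 * t \<and> r \<ge> 2 \<or> l = 2 * t + 1 \<and> r \<ge> 3"
  shows "real (card (cliques E V r)) \<le> clique_const l * real (card V) powr (1 + 1 / real t)"
proof -
  have const: "2 ^ l * (8 * real (28 * (2 * t + 2)) * x) \<le> clique_const l * x" if "x \<ge> 0" for x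
    unfolding clique_const_def using lr that
    by (simp only: mult.assoc) (intro mult_left_mono mult_right_mono, auto)
  \<comment> \<open>\<open>E'\<close> is \<open>E\<close> itself for even \<open>l\<close> and the
    relation of triangle edges for odd \<open>l\<close>.\<close>
  have "\<exists>E'. symp E' \<and> irreflp E' \<and> \<not> has_cycle E' V l \<and> cliques E V r \<subseteq> cliques E' V r \<and>
      real (card (arcs E' V)) \<le> 8 * real (28 * (2 * t + 2)) * real (card V) powr (1 + 1 / real t)"
    using lr
  proof
    assume lr: "l = 2 * t \<and> r \<ge> 2"
    have "real (card (arcs E V)) \<le> real (28 * (2 * t + 2)) * real (card V) powr (1 + 1 / real t)"
      using even_cycle_arcs[OF E V(1), of t] V(2) lr t by simp
    also have "\<dots> \<le> 8 * real (28 * (2 * t + 2)) * real (card V) powr (1 + 1 / real t)"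
      by (intro mult_right_mono) auto
    finally show ?thesis using E V by blast
  next
    assume lr: "l = 2 * t + 1 \<and> r \<ge> 3"
    have "\<not> has_cycle (triangle_edge E V) V l"
      using has_cycle_mono[of "triangle_edge E V" V l V E] V(2) lr by (auto simp: triangle_edge_def)
    then show ?thesis
      using odd_cycle_triangle_arcs[OF E V(1), of t] V(2) lr t triangle_edge_simple[OF E]
        cliques_triangle_edge[of r E V] by (intro exI[of _ "triangle_edge E V"]) simp
  qed
  then obtain E' where E': "symp E'" "irreflp E'" "\<not> has_cycle E' V l" "cliques E V r \<subseteq> cliques E' V r"
    "real (card (arcs E' V)) \<le> 8 * real (28 * (2 * t + 2)) * real (card V) powr (1 + 1 / real t)"
    by blast
  have "card (cliques E V r) \<le> card (cliques E' V r)" using E'(4) V(1) by (intro card_mono) auto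
  also have "\<dots> \<le> 2 ^ l * card (arcs E' V)"
    using lr t by (intro cycle_free_cliques[OF E'(1,2) V(1) E'(3)]) auto
  finally have "real (card (cliques E V r)) \<le> 2 ^ l * real (card (arcs E' V))"
    using of_nat_mono[of _ "2 ^ l * card (arcs E' V)", where ?'a = real] by simp
  also have "\<dots> \<le> 2 ^ l * (8 * real (28 * (2 * t + 2)) * real (card V) powr (1 + 1 / real t))"
    using E'(5) by (intro mult_left_mono) auto
  also have "\<dots> \<le> clique_const l * real (card V) powr (1 + 1 / real t)" by (rule const) simp
  finally show ?thesis .
qed

text \<open>\<open>has_join E l s V\<close> encodes a copy of \<open>K\<^sub>s \<or> C\<^sub>l\<close> in \<open>V\<close>, the vertices of \<open>K\<^sub>s\<close> being
  chosen one after the other.\<close>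

primrec has_join :: "('a \<Rightarrow> 'a \<Rightarrow> bool) \<Rightarrow> nat \<Rightarrow> nat \<Rightarrow> 'a set \<Rightarrow> bool" where
  "has_join E l 0 V = has_cycle E V l"
| "has_join E l (Suc s) V = (\<exists>v\<in>V. has_join E l s (nbh E V v))"

text \<open>Passing to neighbourhoods lowers \<open>r\<close> and \<open>s\<close> together, so the
  required gap between them persists down to the cycle case; each level costs one factor
  \<open>card V\<close>.\<close>

lemma join_free_cliques_powr:
  fixes E :: "'a \<Rightarrow> 'a \<Rightarrow> bool"
  assumes E: "symp E" "irreflp E" and V: "finite V" "\<not> has_join E l s V"
    and t: "t \<ge> 2" and lr: "l = 2 * t \<and> r \<ge> s + 2 \<or> l = 2 * t + 1 \<and> r \<ge> s + 3"
  shows "real (card (cliques E V r)) \<le> clique_const l * real (card V) powr (real s + 1 + 1 / real t)"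
  using V lr
proof (induction s arbitrary: V r)
  case 0
  then show ?case using cycle_free_cliques_powr[OF E, of V l t r] t by (simp add: numeral_2_eq_2)
next
  case (Suc s)
  obtain q where q: "r = Suc q" using Suc.prems by (cases r) auto
  have c0: "clique_const l \<ge> 0" by (simp add: clique_const_def)
  have "real (card (cliques E V r)) \<le> real (\<Sum>v\<in>V. card (cliques E (nbh E V v) q))"
    unfolding q of_nat_le_iff by (rule card_cliques_le_sum_nbh[OF Suc.prems(1)])
  also have "\<dots> = (\<Sum>v\<in>V. real (card (cliques E (nbh E V v) q)))" by simp
  also have "\<dots> \<le> (\<Sum>v\<in>V. clique_const l * real (card V) powr (real s + 1 + 1 / real t))"
  proof (rule sum_mono)
    fix v assume v: "v \<in> V"
    have "real (card (cliques E (nbh E V v) q))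
        \<le> clique_const l * real (card (nbh E V v)) powr (real s + 1 + 1 / real t)"
      using Suc.prems v q by (intro Suc.IH) auto
    also have "\<dots> \<le> clique_const l * real (card V) powr (real s + 1 + 1 / real t)"
      using c0 card_mono[OF Suc.prems(1) nbh_subset] by (intro mult_left_mono powr_mono2) auto
    finally show "real (card (cliques E (nbh E V v) q))
        \<le> clique_const l * real (card V) powr (real s + 1 + 1 / real t)" .
  qed
  also have "\<dots> = clique_const l * (real (card V) powr 1 * real (card V) powr (real s + 1 + 1 / real t))"
    by simp
  also have "\<dots> = clique_const l * real (card V) powr (real (Suc s) + 1 + 1 / real t)"
    unfolding powr_add[symmetric] by (simp add: algebra_simps)
  finally show ?case .
qed

text \<open>Charge each clique to a vertex of minimum degree: the neighbours of \<open>v\<close> whose degree is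
  at least that of \<open>v\<close> number at most \<open>sqrt (card (arcs E V))\<close>.\<close>

lemma cliques_le_arcs_powr:
  fixes E :: "'a \<Rightarrow> 'a \<Rightarrow> bool"
  assumes V: "finite V" and \<alpha>: "\<alpha> \<ge> 1" and C: "C \<ge> 0"
    and local: "\<And>v W. v \<in> V \<Longrightarrow> W \<subseteq> nbh E V v \<Longrightarrow> real (card (cliques E W q)) \<le> C * real (card W) powr \<alpha>"
  shows "real (card (cliques E V (Suc q))) \<le> C * real (card (arcs E V)) powr ((\<alpha> + 1) / 2)"
proof -
  define N where "N = card (arcs E V)"
  define deg where "deg v = card (nbh E V v)" for v
  define M where "M v = {u \<in> nbh E V v. deg v \<le> deg u}" for v
  have MV: "M v \<subseteq> nbh E V v" for v by (auto simp: M_def)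
  have finM: "finite (M v)" for v using MV V by (meson finite_nbh finite_subset)
  have "card (cliques E V (Suc q)) \<le> (\<Sum>v\<in>V. card (cliques E (M v) q))"
  proof (rule card_cliques_le_sum[OF V])
    show "M v \<subseteq> V" for v using MV nbh_subset[of E V] by blast
    fix S assume S: "S \<in> cliques E V (Suc q)"
    then have "finite S" "S \<noteq> {}" by (auto simp: cliques_def card_ge_0_finite)
    then obtain v where v: "v \<in> S" "\<forall>u\<in>S. deg v \<le> deg u"
      by (metis (no_types, lifting) arg_min_if_finite(1) arg_min_least)
    then show "\<exists>v\<in>S. S - {v} \<subseteq> M v" using S
      by (intro bexI[of _ v]) (auto simp: cliques_def M_def nbh_def)
  qed
  then have "real (card (cliques E V (Suc q))) \<le> (\<Sum>v\<in>V. real (card (cliques E (M v) q)))"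
    by (metis of_nat_le_iff of_nat_sum)
  also have "\<dots> \<le> (\<Sum>v\<in>V. C * (real (deg v) * real N powr ((\<alpha> - 1) / 2)))"
  proof (rule sum_mono)
    fix v assume v: "v \<in> V"
    \<comment> \<open>Each vertex of \<open>M v\<close> has degree at least \<open>deg v\<close>,
      hence at least \<open>card (M v)\<close>.\<close>
    have "card (M v) * card (M v) \<le> (\<Sum>u\<in>M v. deg u)"
    proof -
      have "card (M v) \<le> deg v" unfolding deg_def using MV V by (intro card_mono) auto
      then have "(\<Sum>u\<in>M v. card (M v)) \<le> (\<Sum>u\<in>M v. deg u)"
        by (intro sum_mono) (auto simp: M_def)
      then show ?thesis by simp
    qed
    also have "\<dots> \<le> (\<Sum>u\<in>V. deg u)"
      using V MV nbh_subset[of E V v] by (intro sum_mono2) auto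
    also have "\<dots> = N" unfolding N_def deg_def by (rule card_arcs[OF V, symmetric])
    finally have "real (card (M v)) ^ 2 \<le> real N"
      by (simp add: power2_eq_square flip: of_nat_mult)
    then have sq: "real (card (M v)) \<le> real N powr (1 / 2)"
      by (simp add: powr_half_sqrt real_le_rsqrt)
    have "real (card (cliques E (M v) q)) \<le> C * real (card (M v)) powr \<alpha>"
      by (rule local[OF v MV])
    \<comment> \<open>One factor is bounded by \<open>deg v\<close>, which sums to \<open>N\<close>
      over all \<open>v\<close>; the others are bounded by the square root of
      \<open>N\<close>.\<close>
    also have "real (card (M v)) powr \<alpha> = real (card (M v)) powr 1 * real (card (M v)) powr (\<alpha> - 1)"
      unfolding powr_add[symmetric] by simp
    also have "C * \<dots> \<le> C * (real (deg v) * (real N powr (1 / 2)) powr (\<alpha> - 1))"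
      unfolding deg_def using C \<alpha> sq card_mono[OF finite_nbh[OF V] MV]
      by (intro mult_left_mono mult_mono powr_mono2) auto
    also have "(real N powr (1 / 2)) powr (\<alpha> - 1) = real N powr ((\<alpha> - 1) / 2)"
      by (simp add: powr_powr)
    finally show "real (card (cliques E (M v) q)) \<le> C * (real (deg v) * real N powr ((\<alpha> - 1) / 2))" .
  qed
  also have "\<dots> = C * (real (\<Sum>v\<in>V. deg v) * real N powr ((\<alpha> - 1) / 2))"
    by (simp add: sum_distrib_left sum_distrib_right)
  also have "(\<Sum>v\<in>V. deg v) = N" unfolding N_def deg_def by (rule card_arcs[OF V, symmetric])
  also have "real N * real N powr ((\<alpha> - 1) / 2) = real N powr 1 * real N powr ((\<alpha> - 1) / 2)" by simp
  also have "\<dots> = real N powr ((\<alpha> + 1) / 2)" unfolding powr_add[symmetric] by (simp add: field_simps)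
  finally show ?thesis unfolding N_def .
qed

lemma cliques_le_card_powr:
  assumes "finite W" "q \<ge> 1"
  shows "real (card (cliques E W q)) \<le> real (card W) powr real q"
\<comment> \<open>For empty \<open>W\<close> the right side is 0, even at exponent 0;
  \<open>q \<ge> 1\<close> rules out the empty clique.\<close>
proof (cases "W = {}")
  case True
  then show ?thesis using assms by (auto simp: cliques_def)
next
  case False
  have "card (cliques E W q) \<le> card {S. S \<subseteq> W \<and> card S = q}"
    using assms(1) by (intro card_mono) (auto simp: cliques_def)
  also have "\<dots> = card W choose q" by (rule n_subsets[OF assms(1)])
  also have "\<dots> \<le> card W ^ q" by (rule order_trans[OF _ binomial_fact_pow]) simp
  finally have "real (card (cliques E W q)) \<le> real (card W) ^ q" by (metis of_nat_le_iff of_nat_power)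
  then show ?thesis using False assms(1) by (simp add: powr_realpow card_gt_0_iff)
qed

lemma has_join_mono:
  assumes "has_join E l s W" "W \<subseteq> V" "l > 0"
  shows "has_join E l s V"
  using assms(1,2)
proof (induction s arbitrary: V W)
  case 0
  then show ?case using has_cycle_mono[of E W l V E] assms(3) by auto
next
  case (Suc s)
  then obtain v where "v \<in> W" "has_join E l s (nbh E W v)" by auto
  moreover have "has_join E l s (nbh E V v)"
    using Suc.IH[OF \<open>has_join E l s (nbh E W v)\<close> nbh_mono[OF Suc.prems(2)]] .
  ultimately show ?case using Suc.prems(2) by auto
qed

text \<open>Everything chosen after a vertex lies in its neighbourhood, so unfolding the recursion
  makes that vertex adjacent to all later ones.\<close>

lemma has_join_imp_lists:
  assumes "has_join E l s V" "symp E" "irreflp E"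
  shows "\<exists>vs xs. length vs = s \<and> length xs = l \<and> distinct (vs @ xs) \<and> set (vs @ xs) \<subseteq> V \<and>
    (\<forall>x\<in>set vs. \<forall>y\<in>set (vs @ xs). x \<noteq> y \<longrightarrow> E x y) \<and> successively E xs \<and> E (last xs) (hd xs)"
  using assms(1)
proof (induction s arbitrary: V)
  case 0
  then show ?case unfolding has_join.simps has_cycle_def by auto
next
  case (Suc s)
  then obtain v where v: "v \<in> V" "has_join E l s (nbh E V v)" by auto
  from Suc.IH[OF v(2)] obtain vs xs where vx: "length vs = s" "length xs = l" "distinct (vs @ xs)"
    "set (vs @ xs) \<subseteq> nbh E V v" "\<forall>x\<in>set vs. \<forall>y\<in>set (vs @ xs). x \<noteq> y \<longrightarrow> E x y"
    "successively E xs" "E (last xs) (hd xs)" by blast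
  have adj: "E v y" "E y v" "y \<in> V" "y \<noteq> v" if "y \<in> set (vs @ xs)" for y
  proof -
    have "y \<in> nbh E V v" using vx(4) that by blast
    then show "E v y" "E y v" "y \<in> V" "y \<noteq> v"
      using assms(2,3) by (auto simp: nbh_def symp_def irreflp_def)
  qed
  have "distinct ((v # vs) @ xs)" using vx(3) adj(4) by auto
  moreover have "set ((v # vs) @ xs) \<subseteq> V" using adj(3) v(1) by auto
  moreover have "\<forall>x\<in>set (v # vs). \<forall>y\<in>set ((v # vs) @ xs). x \<noteq> y \<longrightarrow> E x y"
    using vx(5) adj(1,2) by auto
  ultimately show ?case using vx(1,2,6,7) by (intro exI[of _ "v # vs"] exI[of _ xs]) simp
qed

subsection \<open>Copies in simple graphs\<close>

definition adj :: "'a sgraph \<Rightarrow> 'a \<Rightarrow> 'a \<Rightarrow> bool" where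
  "adj G u v \<longleftrightarrow> {u, v} \<in> edges G"

lemma symp_adj: "symp (adj G)"
  by (auto simp: symp_def adj_def insert_commute)

lemma irreflp_adj:
  fixes G :: "'a sgraph"
  assumes "simple_graph G" shows "irreflp (adj G)"
proof (rule irreflpI)
  fix v :: 'a
  have "card {v, v} \<noteq> 2" by simp
  with assms show "\<not> adj G v v" unfolding adj_def simple_graph_def by blast
qed

lemma finite_edges: "simple_graph G \<Longrightarrow> finite (edges G)"
  unfolding simple_graph_def by (rule finite_subset[of _ "Pow (verts G)"]) auto

lemma card_arcs_adj_le:
  assumes "simple_graph G"
  shows "card (arcs (adj G) (verts G)) \<le> 2 * card (edges G)"
proof -
  let ?A = "\<lambda>e. {(u, v). {u, v} = e}"
  have A: "finite (?A e) \<and> card (?A e) \<le> 2" if "e \<in> edges G" for e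
  proof -
    have "card e = 2" using assms that by (auto simp: simple_graph_def)
    then obtain a b where e: "e = {a, b}" by (meson card_2_iff)
    have sub: "?A e \<subseteq> {(a, b), (b, a)}" unfolding e by (auto simp: doubleton_eq_iff)
    have "card (?A e) \<le> card {(a, b), (b, a)}" by (rule card_mono[OF _ sub]) simp
    also have "\<dots> \<le> 2" by (cases "a = b") auto
    finally show ?thesis using finite_subset[OF sub] by simp
  qed
  have "arcs (adj G) (verts G) \<subseteq> (\<Union>e\<in>edges G. ?A e)" by (auto simp: arcs_def adj_def)
  then have "card (arcs (adj G) (verts G)) \<le> card (\<Union>e\<in>edges G. ?A e)"
    using A finite_edges[OF assms] by (intro card_mono) auto
  also have "\<dots> \<le> (\<Sum>e\<in>edges G. card (?A e))" by (rule card_UN_le[OF finite_edges[OF assms]])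
  also have "\<dots> \<le> (\<Sum>e\<in>edges G. 2)" using A by (intro sum_mono) blast
  finally show ?thesis by simp
qed

lemma image_pairs_bij:
  assumes "bij_betw f A B"
  shows "(\<lambda>e. f ` e) ` {e. e \<subseteq> A \<and> card e = 2} = {e. e \<subseteq> B \<and> card e = 2}"
proof (intro equalityI subsetI)
  fix e assume "e \<in> (\<lambda>e. f ` e) ` {e. e \<subseteq> A \<and> card e = 2}"
  then show "e \<in> {e. e \<subseteq> B \<and> card e = 2}"
    using assms by (auto simp: bij_betw_def card_image inj_on_subset)
next
  fix e assume e: "e \<in> {e. e \<subseteq> B \<and> card e = 2}"
  let ?g = "the_inv_into A f"
  have g: "bij_betw ?g B A" by (rule bij_betw_the_inv_into[OF assms])
  have "?g ` e \<subseteq> A" "card (?g ` e) = 2"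
    using e g by (auto simp: bij_betw_def card_image inj_on_subset)
  moreover have "f ` ?g ` e = e"
    using e assms by (force simp: image_image bij_betw_def f_the_inv_into_f subset_iff)
  ultimately show "e \<in> (\<lambda>e. f ` e) ` {e. e \<subseteq> A \<and> card e = 2}" by (intro image_eqI[of _ _ "?g ` e"]) auto
qed

text \<open>A copy of a complete graph contains all pairs of its vertices and is thus determined by
  its vertex set, so no factor for automorphisms arises.\<close>

lemma card_copies_complete_graph:
  assumes G: "simple_graph G"
  shows "card (copies (complete_graph r) G) = card (cliques (adj G) (verts G) r)"
proof -
  let ?K = "\<lambda>S. SGraph S {e. e \<subseteq> S \<and> card e = 2}"
  have "copies (complete_graph r) G = ?K ` cliques (adj G) (verts G) r"
  proof (intro equalityI subsetI)
    fix H assume "H \<in> copies (complete_graph r) G"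
    then obtain f where H: "subgraph H G" and f: "bij_betw f {..<r} (verts H)"
      and "edges H = (\<lambda>e. f ` e) ` {e. e \<subseteq> {..<r} \<and> card e = 2}"
      by (auto simp: copies_def graph_iso_def complete_graph_def)
    then have eH: "edges H = {e. e \<subseteq> verts H \<and> card e = 2}" using image_pairs_bij[OF f] by simp
    have "card (verts H) = r" using bij_betw_same_card[OF f] by simp
    moreover have "adj G x y" if "x \<in> verts H" "y \<in> verts H" "x \<noteq> y" for x y
    proof -
      have "{x, y} \<in> edges H" using eH that by auto
      then show ?thesis using H by (auto simp: subgraph_def adj_def)
    qed
    ultimately have "verts H \<in> cliques (adj G) (verts G) r"
      using H by (auto simp: cliques_def subgraph_def)
    moreover have "H = ?K (verts H)" using eH by (cases H) auto
    ultimately show "H \<in> ?K ` cliques (adj G) (verts G) r" by blast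
  next
    fix H assume "H \<in> ?K ` cliques (adj G) (verts G) r"
    then obtain S where S: "S \<in> cliques (adj G) (verts G) r" "H = ?K S" by blast
    have fin: "finite S" using S(1) G by (auto simp: cliques_def simple_graph_def intro: finite_subset)
    then obtain f where f: "bij_betw f {..<r} S"
      using ex_bij_betw_nat_finite[OF fin] S(1) by (auto simp: cliques_def atLeast0LessThan)
    have "e \<in> edges G" if e: "e \<subseteq> S" "card e = 2" for e
    proof -
      obtain x y where "e = {x, y}" "x \<noteq> y" using e(2) by (auto simp: card_2_iff)
      then show ?thesis using e(1) S(1) by (auto simp: cliques_def adj_def)
    qed
    then have "subgraph H G" using S fin by (auto simp: subgraph_def simple_graph_def cliques_def)
    moreover have "graph_iso (complete_graph r) H"
      unfolding graph_iso_def using f image_pairs_bij[OF f] S(2)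
      by (intro exI[of _ f]) (simp add: complete_graph_def)
    ultimately show "H \<in> copies (complete_graph r) G" by (simp add: copies_def)
  qed
  moreover have "inj_on ?K (cliques (adj G) (verts G) r)" by (auto intro: inj_onI)
  ultimately show ?thesis by (simp add: card_image)
qed

lemma not_graph_freeI:
  assumes F: "\<And>e. e \<in> edges F \<Longrightarrow> e \<subseteq> verts F" and G: "simple_graph G"
    and f: "inj_on f (verts F)" "f ` verts F \<subseteq> verts G" "\<And>e. e \<in> edges F \<Longrightarrow> f ` e \<in> edges G"
  shows "\<not> graph_free F G"
proof -
  let ?H = "SGraph (f ` verts F) ((\<lambda>e. f ` e) ` edges F)"
  have "simple_graph ?H"
  proof -
    have "finite (f ` verts F)" using f(2) G by (auto simp: simple_graph_def intro: finite_subset)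
    moreover have "f ` e \<subseteq> f ` verts F" "card (f ` e) = 2" if "e \<in> edges F" for e
      using F[OF that] f(3)[OF that] G by (auto simp: simple_graph_def)
    ultimately show ?thesis by (auto simp: simple_graph_def)
  qed
  then have "subgraph ?H G" using f by (auto simp: subgraph_def)
  moreover have "graph_iso F ?H"
    unfolding graph_iso_def using f(1) by (intro exI[of _ f]) (auto simp: bij_betw_def)
  ultimately show ?thesis unfolding graph_free_def copies_def by blast
qed

lemma edges_join_cycle:
  "edges (graph_join (complete_graph s) (cycle_graph l)) =
    {{Inl i, Inl j} | i j. i < s \<and> j < s \<and> i \<noteq> j} \<union> {{Inr i, Inr (Suc i mod l)} | i. i < l}
    \<union> {{Inl i, Inr j} | i j. i < s \<and> j < l}"
proof -
  have "(\<lambda>e. Inl ` e) ` {e. e \<subseteq> {..<s} \<and> card e = 2} =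
      ({{Inl i, Inl j} | i j. i < s \<and> j < s \<and> i \<noteq> j} :: (nat + nat) set set)"
  proof (intro equalityI subsetI)
    fix x :: "(nat + nat) set" assume "x \<in> (\<lambda>e. Inl ` e) ` {e. e \<subseteq> {..<s} \<and> card e = 2}"
    then show "x \<in> {{Inl i, Inl j} | i j. i < s \<and> j < s \<and> i \<noteq> j}" by (auto simp: card_2_iff)
  next
    fix x :: "(nat + nat) set" assume "x \<in> {{Inl i, Inl j} | i j. i < s \<and> j < s \<and> i \<noteq> j}"
    then obtain i j where "x = Inl ` {i, j}" "i < s" "j < s" "i \<noteq> j" by auto
    then show "x \<in> (\<lambda>e. Inl ` e) ` {e. e \<subseteq> {..<s} \<and> card e = 2}" by (intro image_eqI[of _ _ "{i, j}"]) auto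
  qed
  moreover have "(\<lambda>e. Inr ` e) ` {{i, Suc i mod l} | i. i < l} =
      ({{Inr i, Inr (Suc i mod l)} | i. i < l} :: (nat + nat) set set)"
    by (auto simp: image_iff) blast
  ultimately show ?thesis by (simp add: graph_join_def complete_graph_def cycle_graph_def)
qed

lemma verts_join_cycle:
  "verts (graph_join (complete_graph s) (cycle_graph l)) = {..<s} <+> {..<l}"
  by (simp add: graph_join_def complete_graph_def cycle_graph_def)

text \<open>The two lists, read as functions of the index, embed the join; the cyclic edge at index
  \<open>l - 1\<close> is the closing edge of the list.\<close>

lemma join_free_not_has_join:
  assumes G: "simple_graph G" and l: "l > 0"
    and free: "graph_free (graph_join (complete_graph s) (cycle_graph l)) G"
  shows "\<not> has_join (adj G) l s (verts G)"
proof
  assume "has_join (adj G) l s (verts G)"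
  from has_join_imp_lists[OF this symp_adj irreflp_adj[OF G]] obtain vs xs where
    len: "length vs = s" "length xs = l" and dist: "distinct (vs @ xs)" and V: "set (vs @ xs) \<subseteq> verts G"
    and adj: "\<forall>x\<in>set vs. \<forall>y\<in>set (vs @ xs). x \<noteq> y \<longrightarrow> adj G x y"
    and cyc: "successively (adj G) xs" "adj G (last xs) (hd xs)" by blast
  let ?F = "graph_join (complete_graph s) (cycle_graph l)"
  let ?f = "case_sum (\<lambda>i. vs ! i) (\<lambda>j. xs ! j)"
  have ne: "xs \<noteq> []" using len l by auto
  have "\<not> graph_free ?F G"
  proof (rule not_graph_freeI[OF _ G])
    show "e \<subseteq> verts ?F" if "e \<in> edges ?F" for e
      using that l unfolding edges_join_cycle verts_join_cycle by auto
    show "inj_on ?f (verts ?F)"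
      unfolding verts_join_cycle inj_on_def using dist len
      by (auto simp: nth_eq_iff_index_eq) (metis IntI emptyE nth_mem)+
    show "?f ` verts ?F \<subseteq> verts G"
      unfolding verts_join_cycle using V len by auto
    fix e assume "e \<in> edges ?F"
    then consider (a) i j where "e = {Inl i, Inl j}" "i < s" "j < s" "i \<noteq> j"
      | (b) i where "e = {Inr i, Inr (Suc i mod l)}" "i < l"
      | (c) i j where "e = {Inl i, Inr j}" "i < s" "j < l"
      unfolding edges_join_cycle by blast
    then show "?f ` e \<in> edges G"
    proof cases
      case a
      then have "vs ! i \<noteq> vs ! j" using dist len by (simp add: nth_eq_iff_index_eq)
      then have "adj G (vs ! i) (vs ! j)" using a adj len by auto
      then show ?thesis using a by (simp add: adj_def)
    next
      case b
      have "adj G (xs ! i) (xs ! (Suc i mod l))"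
      proof (cases "Suc i < l")
        case True
        then show ?thesis using cyc(1) len by (simp add: successively_conv_nth)
      next
        case False
        then have "Suc i = l" using b(2) by simp
        then have "i = l - 1" "Suc i mod l = 0" by auto
        then show ?thesis using cyc(2) ne len by (simp add: last_conv_nth hd_conv_nth)
      qed
      then show ?thesis using b by (simp add: adj_def)
    next
      case c
      then have "vs ! i \<in> set vs" "xs ! j \<in> set xs" using len by auto
      then have "vs ! i \<noteq> xs ! j" using dist by auto
      then have "adj G (vs ! i) (xs ! j)" using c adj \<open>vs ! i \<in> set vs\<close> \<open>xs ! j \<in> set xs\<close> by auto
      then show ?thesis using c by (simp add: adj_def)
    qed
  qed
  then show False using free by blast
qed

section \<open>Colourings of the join and the multipartite host\<close>

text \<open>With two colours the positions \<open>j\<close> and \<open>j + 2\<close> agree, so the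
  even position \<open>l - 1\<close> gets the colour of its successor 0.\<close>

lemma odd_cycle_not_2_colourable:
  assumes "odd l" "l > 1" "finite B" "card B \<le> 2" "\<And>j. j < l \<Longrightarrow> b j \<in> B"
    and ne: "\<And>j. j < l \<Longrightarrow> b j \<noteq> b (Suc j mod l)"
  shows False
proof -
  have two: "b (Suc (Suc j)) = b j" if "Suc (Suc j) < l" for j
  proof (rule ccontr)
    assume "b (Suc (Suc j)) \<noteq> b j"
    then have "card {b j, b (Suc j), b (Suc (Suc j))} = 3"
      using ne[of j] ne[of "Suc j"] that by auto
    moreover have "card {b j, b (Suc j), b (Suc (Suc j))} \<le> card B"
      using assms that by (intro card_mono) auto
    ultimately show False using assms(4) by simp
  qed
  have "b (2 * i) = b 0" if "2 * i < l" for i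
    using that by (induction i) (auto simp: two)
  then have "b (l - 1) = b 0" using assms(1,2) by (auto elim!: oddE)
  then show False using ne[of "l - 1"] assms(2) by simp
qed

text \<open>The complete part uses \<open>s\<close> distinct colours, none of which recurs on the
  cycle; the cycle needs two more, or three if it is odd.\<close>

lemma join_cycle_colours:
  assumes l: "l \<ge> 3" and free: "\<not> graph_free (graph_join (complete_graph s) (cycle_graph l)) G"
    and col: "\<And>v. v \<in> verts G \<Longrightarrow> c v < k" "\<And>u v. adj G u v \<Longrightarrow> c u \<noteq> c v"
  shows "k \<ge> s + 2 \<and> (odd l \<longrightarrow> k \<ge> s + 3)"
proof -
  let ?F = "graph_join (complete_graph s) (cycle_graph l)"
  obtain H f where H: "subgraph H G" and f: "bij_betw f (verts ?F) (verts H)"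
    and eH: "edges H = (\<lambda>e. f ` e) ` edges ?F"
    using free unfolding graph_free_def copies_def graph_iso_def by blast
  have vert: "c (f x) < k" if "x \<in> verts ?F" for x
    using col(1) f H that by (auto simp: bij_betw_def subgraph_def)
  have edge: "c (f x) \<noteq> c (f y)" if "{x, y} \<in> edges ?F" for x y
  proof -
    have "f ` {x, y} \<in> edges G" using eH H that by (auto simp: subgraph_def)
    then show ?thesis using col(2)[of "f x" "f y"] by (simp add: adj_def)
  qed
  define a where "a i = c (f (Inl i))" for i
  define b where "b j = c (f (Inr j))" for j
  have inj: "inj_on a {..<s}"
  proof (rule inj_onI, rule ccontr)
    fix i j assume ij: "i \<in> {..<s}" "j \<in> {..<s}" "a i = a j" "i \<noteq> j"
    then have "{Inl i, Inl j} \<in> edges ?F" by (auto simp: edges_join_cycle)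
    from edge[OF this] show False using ij(3) by (simp add: a_def)
  qed
  have ab: "a i \<noteq> b j" if "i < s" "j < l" for i j
    unfolding a_def b_def using that by (intro edge) (auto simp: edges_join_cycle)
  have bb: "b j \<noteq> b (Suc j mod l)" if "j < l" for j
    unfolding b_def using that by (intro edge) (auto simp: edges_join_cycle)
  define B where "B = {..<k} - a ` {..<s}"
  have bB: "b j \<in> B" if "j < l" for j
    using vert[of "Inr j"] ab[of _ j] that unfolding B_def b_def verts_join_cycle by force
  have "a ` {..<s} \<subseteq> {..<k}" using vert unfolding a_def verts_join_cycle by auto
  then have cB: "card B = k - s" "s \<le> k"
    unfolding B_def using inj card_mono[of "{..<k}" "a ` {..<s}"]
    by (auto simp: card_Diff_subset card_image)
  have "b 0 \<noteq> b 1" using bb[of 0] l by simp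
  then have "card {b 0, b 1} = 2" by simp
  moreover have "card {b 0, b 1} \<le> card B" using bB[of 0] bB[of 1] l by (intro card_mono) (auto simp: B_def)
  ultimately have "k \<ge> s + 2" using cB by linarith
  moreover have "k \<ge> s + 3" if "odd l"
  proof (rule ccontr)
    assume "\<not> ?thesis"
    then have "card B \<le> 2" using cB by linarith
    then show False
      using odd_cycle_not_2_colourable[of l B b] bB bb that l by (simp add: B_def)
  qed
  ultimately show ?thesis by blast
qed

text \<open>Residues modulo \<open>k\<close> are the colours. The vertices below
  \<open>k * a\<close> span a complete multipartite graph with classes of size \<open>a\<close> and
  at most \<open>m\<close> edges; a matching between residues 0 and 1 further out supplies the
  missing edges without spoiling the colouring.\<close>

lemma multipartite_construction:
  assumes k: "k \<ge> 2" and a: "(k * a) ^ 2 \<le> m"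
  shows "\<exists>G :: nat sgraph. simple_graph G \<and> card (edges G) = m \<and>
    (\<forall>u v. adj G u v \<longrightarrow> u mod k \<noteq> v mod k) \<and> a ^ k \<le> card (cliques (adj G) (verts G) k)"
proof -
  define E0 where "E0 = {{u, v} | u v. u < k * a \<and> v < k * a \<and> u mod k \<noteq> v mod k}"
  have E0_sub: "E0 \<subseteq> (\<lambda>(u, v). {u, v}) ` ({..<k * a} \<times> {..<k * a})" unfolding E0_def by force
  then have finE0: "finite E0" by (rule finite_subset) simp
  have "card E0 \<le> card ({..<k * a} \<times> {..<k * a})"
    using E0_sub by (rule surj_card_le[rotated]) simp
  then have cE0: "card E0 \<le> m" using a by (simp add: power2_eq_square)
  define mt where "mt i = {k * (a + i), k * (a + i) + 1}" for i :: nat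
  define E1 where "E1 = mt ` {..<m - card E0}"
  have "inj mt"
  proof (rule injI)
    fix i j assume "mt i = mt j"
    then have "Min (mt i) = Min (mt j)" by simp
    then show "i = j" using k by (simp add: mt_def)
  qed
  then have cE1: "card E1 = m - card E0" unfolding E1_def by (simp add: card_image inj_on_subset)
  have "E0 \<inter> E1 = {}"
  proof -
    have "e \<subseteq> {..<k * a}" if "e \<in> E0" for e using that by (auto simp: E0_def)
    moreover have "\<not> mt i \<subseteq> {..<k * a}" for i by (auto simp: mt_def)
    ultimately show ?thesis unfolding E1_def by blast
  qed
  then have cE: "card (E0 \<union> E1) = m"
    using cE0 cE1 finE0 by (subst card_Un_disjoint) (auto simp: E1_def)
  define G where "G = SGraph {..<k * (a + m) + 2} (E0 \<union> E1)"
  have col: "u mod k \<noteq> v mod k" if "adj G u v" for u v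
  proof -
    have "{u, v} \<in> E0 \<union> E1" using that by (simp add: adj_def G_def)
    then show ?thesis
    proof
      assume "{u, v} \<in> E0"
      then show ?thesis by (auto simp: E0_def doubleton_eq_iff)
    next
      assume "{u, v} \<in> E1"
      then obtain i where "{u, v} = {k * (a + i), k * (a + i) + 1}" by (auto simp: E1_def mt_def)
      moreover have "(k * (a + i) + 1) mod k = 1"
        using k mod_mult_self4[of k "a + i" 1] by simp
      moreover have "(k * (a + i)) mod k = 0" by simp
      ultimately show ?thesis by (metis doubleton_eq_iff zero_neq_one)
    qed
  qed
  have "simple_graph G"
  proof -
    have "e \<subseteq> {..<k * (a + m) + 2} \<and> card e = 2" if "e \<in> E0 \<union> E1" for e
      using that
    proof
      assume "e \<in> E0"
      then obtain u v where e: "e = {u, v}" "u < k * a" "v < k * a" "u mod k \<noteq> v mod k"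
        by (auto simp: E0_def)
      then have "u \<noteq> v" by auto
      moreover have "k * a \<le> k * (a + m) + 2" by (simp add: algebra_simps)
      ultimately show ?thesis using e by auto
    next
      assume "e \<in> E1"
      then obtain i where i: "e = mt i" "i < m" by (auto simp: E1_def)
      then obtain p where "e = {p, p + 1}" "p \<le> k * (a + m)" by (auto simp: mt_def)
      then show ?thesis by auto
    qed
    then show ?thesis by (auto simp: simple_graph_def G_def)
  qed
  moreover have "a ^ k \<le> card (cliques (adj G) (verts G) k)"
  proof -
    \<comment> \<open>\<open>f\<close> selects one vertex of each residue class; these transversals
      are the \<open>a ^ k\<close> cliques.\<close>
    define T where "T f = (\<lambda>i. k * f i + i) ` {..<k}" for f :: "nat \<Rightarrow> nat"
    have elt: "(k * f i + i) mod k = i" "(k * f i + i) div k = f i" if "i < k" for f i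
      using that by auto
    have clique: "T f \<in> cliques (adj G) (verts G) k" if f: "f \<in> {..<k} \<rightarrow>\<^sub>E {..<a}" for f
    proof -
      have inj: "inj_on (\<lambda>i. k * f i + i) {..<k}" by (rule inj_onI) (metis elt(1) lessThan_iff)
      have lt: "k * f i + i < k * a" if "i < k" for i
      proof -
        have "Suc (f i) \<le> a" using f that by (auto simp: PiE_iff Suc_le_eq)
        then have "k * Suc (f i) \<le> k * a" by (rule mult_le_mono2)
        then show ?thesis using that by simp
      qed
      have "card (T f) = k" unfolding T_def using inj by (simp add: card_image)
      moreover have "T f \<subseteq> verts G"
        unfolding T_def G_def using lt by (fastforce simp: algebra_simps)
      moreover have "adj G x y" if "x \<in> T f" "y \<in> T f" "x \<noteq> y" for x y
      proof -
        obtain i j where ij: "x = k * f i + i" "y = k * f j + j" "i < k" "j < k"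
          using \<open>x \<in> T f\<close> \<open>y \<in> T f\<close> unfolding T_def by blast
        then have "x mod k \<noteq> y mod k" using that(3) elt(1) by metis
        then have "{x, y} \<in> E0" unfolding E0_def using ij lt by blast
        then show ?thesis by (simp add: adj_def G_def)
      qed
      ultimately show ?thesis by (auto simp: cliques_def)
    qed
    have "inj_on T ({..<k} \<rightarrow>\<^sub>E {..<a})"
    proof (rule inj_onI)
      fix f g assume fg: "f \<in> {..<k} \<rightarrow>\<^sub>E {..<a}" "g \<in> {..<k} \<rightarrow>\<^sub>E {..<a}" "T f = T g"
      show "f = g"
      proof (rule PiE_ext[OF fg(1,2)])
        fix i assume i: "i \<in> {..<k}"
        then have "k * f i + i \<in> T g" using fg(3) unfolding T_def by blast
        then obtain j where j: "j < k" "k * f i + i = k * g j + j" unfolding T_def by blast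
        then have "i = j" using elt(1)[of i f] elt(1)[of j g] i by simp
        then show "f i = g i" using j(2) k by simp
      qed
    qed
    then have "card (T ` ({..<k} \<rightarrow>\<^sub>E {..<a})) = a ^ k" by (simp add: card_image card_PiE)
    moreover have "card (T ` ({..<k} \<rightarrow>\<^sub>E {..<a})) \<le> card (cliques (adj G) (verts G) k)"
      using clique \<open>simple_graph G\<close> by (intro card_mono) (auto simp: simple_graph_def)
    ultimately show ?thesis by simp
  qed
  moreover have "card (edges G) = m" using cE by (simp add: G_def)
  ultimately show ?thesis using col by blast
qed

section \<open>Bounds on mex\<close>

text \<open>\<open>Max\<close> is meaningful on a finite nonempty set: \<open>B\<close> provides
  finiteness and \<open>G0\<close> an element.\<close>

lemma mex_bounds:
  fixes H :: "'a sgraph" and F :: "'b sgraph" and G0 :: "nat sgraph"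
  assumes G0: "simple_graph G0" "card (edges G0) = m" "graph_free F G0"
    and B: "\<And>G :: nat sgraph. simple_graph G \<Longrightarrow> card (edges G) = m \<Longrightarrow> graph_free F G \<Longrightarrow>
      real (card (copies H G)) \<le> B"
  shows "real (mex m H F) \<le> B \<and> card (copies H G0) \<le> mex m H F"
proof -
  let ?S = "{card (copies H G) | G :: nat sgraph.
     simple_graph G \<and> card (edges G) = m \<and> graph_free F G}"
  have "?S \<subseteq> {..nat \<lfloor>B\<rfloor>}" using B by (auto simp: le_nat_floor)
  then have fin: "finite ?S" by (rule finite_subset) simp
  have in_S: "card (copies H G0) \<in> ?S" using G0 by blast
  then have "Max ?S \<in> ?S" using fin by (intro Max_in) auto
  then have "real (mex m H F) \<le> B" unfolding mex_def using B by auto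
  moreover have "card (copies H G0) \<le> mex m H F" unfolding mex_def using Max_ge[OF fin in_S] .
  ultimately show ?thesis by blast
qed

text \<open>The power of 2 arises because \<open>arcs\<close> counts every edge in both
  directions.\<close>

lemma copies_le_powr:
  assumes G: "simple_graph G" and \<alpha>: "\<alpha> \<ge> 1" and C: "C \<ge> 0" and r: "r \<ge> 1"
    and local: "\<And>v W. v \<in> verts G \<Longrightarrow> W \<subseteq> nbh (adj G) (verts G) v \<Longrightarrow>
      real (card (cliques (adj G) W (r - 1))) \<le> C * real (card W) powr \<alpha>"
  shows "real (card (copies (complete_graph r) G))
    \<le> C * 2 powr ((\<alpha> + 1) / 2) * real (card (edges G)) powr ((\<alpha> + 1) / 2)"
proof -
  have "real (card (copies (complete_graph r) G)) = real (card (cliques (adj G) (verts G) (Suc (r - 1))))"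
    using r by (simp add: card_copies_complete_graph[OF G])
  also have "\<dots> \<le> C * real (card (arcs (adj G) (verts G))) powr ((\<alpha> + 1) / 2)"
    using G by (intro cliques_le_arcs_powr[OF _ \<alpha> C local]) (auto simp: simple_graph_def)
  also have "\<dots> \<le> C * (2 * real (card (edges G))) powr ((\<alpha> + 1) / 2)"
    using C \<alpha> of_nat_mono[OF card_arcs_adj_le[OF G], where ?'a = real]
    by (intro mult_left_mono powr_mono2) auto
  finally show ?thesis by (simp add: powr_mult mult.assoc)
qed

theorem theorem4p9:
  fixes r l s :: nat
  assumes "r \<ge> 3" and "l \<ge> 4" and "s \<ge> 1"
  shows "(\<forall>t::nat. t \<ge> 2 \<and> (l = 2 * t \<and> r \<ge> s + 2 \<or> l = 2 * t + 1 \<and> r \<ge> s + 3) \<longrightarrow>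
            (\<lambda>m. real (mex m (complete_graph r) (graph_join (complete_graph s) (cycle_graph l))))
              \<in> O(\<lambda>m. real m powr ((real s + 1) / 2 + 1 / (2 * real t))))
       \<and> (\<not> (\<exists>t::nat. t \<ge> 2 \<and> (l = 2 * t \<and> r \<ge> s + 2 \<or> l = 2 * t + 1 \<and> r \<ge> s + 3)) \<longrightarrow>
            (\<lambda>m. real (mex m (complete_graph r) (graph_join (complete_graph s) (cycle_graph l))))
              \<in> \<Theta>(\<lambda>m. real m powr (real r / 2)))"
proof (intro conjI allI impI)
  let ?F = "graph_join (complete_graph s) (cycle_graph l)"
  let ?mex = "\<lambda>m. mex m (complete_graph r) ?F"
  \<comment> \<open>The host is \<open>k\<close>-coloured, whereas by
    \<open>join_cycle_colours\<close> the join has no colouring with \<open>k\<close>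
    colours.\<close>
  have host: "\<exists>G :: nat sgraph. simple_graph G \<and> card (edges G) = m \<and> graph_free ?F G \<and>
      a ^ k \<le> card (copies (complete_graph k) G)"
    if k: "k \<ge> 2" "(k * a) ^ 2 \<le> m" "\<not> (k \<ge> s + 2 \<and> (odd l \<longrightarrow> k \<ge> s + 3))" for k a m
  proof -
    obtain G :: "nat sgraph" where G: "simple_graph G" "card (edges G) = m"
      "\<And>u v. adj G u v \<Longrightarrow> u mod k \<noteq> v mod k" "a ^ k \<le> card (cliques (adj G) (verts G) k)"
      using multipartite_construction[OF k(1,2)] by blast
    have "graph_free ?F G"
      using join_cycle_colours[of l s G "\<lambda>v. v mod k" k] G(3) k assms(2) by auto
    then show ?thesis using G card_copies_complete_graph[OF G(1), of k] by auto
  qed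
  {
    fix t assume t: "t \<ge> 2 \<and> (l = 2 * t \<and> r \<ge> s + 2 \<or> l = 2 * t + 1 \<and> r \<ge> s + 3)"
    \<comment> \<open>The clique exponent inside neighbourhoods, where the join with one vertex less
      in its complete part is excluded.\<close>
    define \<alpha> where "\<alpha> = real s + 1 / real t"
    have "real s \<ge> 1" "1 / real t \<ge> 0" using assms(3) by auto
    then have \<alpha>: "\<alpha> \<ge> 1" "\<alpha> = real (s - 1) + 1 + 1 / real t"
      using assms(3) unfolding \<alpha>_def by (linarith, simp add: of_nat_diff)
    have exp: "(\<alpha> + 1) / 2 = (real s + 1) / 2 + 1 / (2 * real t)"
      unfolding \<alpha>_def by (simp add: field_simps)
    let ?C = "clique_const l * 2 powr ((\<alpha> + 1) / 2)"
    have "real (?mex m) \<le> ?C * real m powr ((\<alpha> + 1) / 2)" for m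
    proof -
      \<comment> \<open>With \<open>a = 0\<close> the host is just a matching; two colours are too
        few for the join because \<open>s \<ge> 1\<close>.\<close>
      obtain G0 :: "nat sgraph" where G0: "simple_graph G0" "card (edges G0) = m" "graph_free ?F G0"
        using host[of 2 0 m] assms(3) by auto
      have "real (card (copies (complete_graph r) G)) \<le> ?C * real m powr ((\<alpha> + 1) / 2)"
        if G: "simple_graph G" "card (edges G) = m" "graph_free ?F G" for G :: "nat sgraph"
      proof -
        \<comment> \<open>Writing \<open>s\<close> as a successor exposes one level of
          \<open>has_join\<close>, which speaks about neighbourhoods.\<close>
        have nj: "\<not> has_join (adj G) l (Suc (s - 1)) (verts G)"
          using join_free_not_has_join[OF G(1) _ G(3)] assms by simp
        have "real (card (cliques (adj G) W (r - 1))) \<le> clique_const l * real (card W) powr \<alpha>"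
          if v: "v \<in> verts G" and W: "W \<subseteq> nbh (adj G) (verts G) v" for v W
        proof -
          have "finite W" using W G(1) by (meson finite_nbh finite_subset simple_graph_def)
          moreover have "\<not> has_join (adj G) l (s - 1) W"
            using nj v has_join_mono[OF _ W, of "adj G" l "s - 1"] assms(2) by auto
          ultimately show ?thesis
            unfolding \<alpha>(2) using t assms(3)
            by (intro join_free_cliques_powr[OF symp_adj irreflp_adj[OF G(1)]]) auto
        qed
        then show ?thesis
          using copies_le_powr[OF G(1) \<alpha>(1), of "clique_const l" r] G(2) assms(1)
          by (simp add: clique_const_def)
      qed
      then show ?thesis using mex_bounds[OF G0] by blast
    qed
    then show "(\<lambda>m. real (?mex m)) \<in> O(\<lambda>m. real m powr ((real s + 1) / 2 + 1 / (2 * real t)))"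
      unfolding exp by (intro bigoI[of _ ?C] always_eventually) (simp add: exp)
  }
  assume none: "\<not> (\<exists>t. t \<ge> 2 \<and> (l = 2 * t \<and> r \<ge> s + 2 \<or> l = 2 * t + 1 \<and> r \<ge> s + 3))"
  \<comment> \<open>Since \<open>l \<ge> 4\<close>, the candidate \<open>t = l div 2\<close> is at
    least 2, so case (ii) means that \<open>r\<close> colours do not suffice for the join.\<close>
  have small: "\<not> (r \<ge> s + 2 \<and> (odd l \<longrightarrow> r \<ge> s + 3))"
  proof
    assume *: "r \<ge> s + 2 \<and> (odd l \<longrightarrow> r \<ge> s + 3)"
    have "l = 2 * (l div 2) \<or> odd l \<and> l = 2 * (l div 2) + 1" "l div 2 \<ge> 2" using assms(2) by presburger+
    then show False using none * by blast
  qed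
  let ?C = "2 powr (real r / 2)"
  have upper: "real (card (copies (complete_graph r) G)) \<le> ?C * real m powr (real r / 2)"
    if G: "simple_graph G" "card (edges G) = m" for G :: "nat sgraph" and m
  proof -
    \<comment> \<open>The trivial count with exponent \<open>r - 1\<close> in neighbourhoods already
      yields \<open>r / 2\<close>.\<close>
    have "real (card (cliques (adj G) W (r - 1))) \<le> 1 * real (card W) powr real (r - 1)"
      if "W \<subseteq> nbh (adj G) (verts G) v" for v W
    proof -
      have "finite W" using that G(1) by (meson finite_nbh finite_subset simple_graph_def)
      then show ?thesis using cliques_le_card_powr[of W "r - 1" "adj G"] assms(1) by simp
    qed
    then have "real (card (copies (complete_graph r) G)) \<le> 1 * 2 powr ((real (r - 1) + 1) / 2)
        * real (card (edges G)) powr ((real (r - 1) + 1) / 2)"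
      using assms(1) by (intro copies_le_powr[OF G(1)]) auto
    moreover have "real (r - 1) + 1 = real r" using assms(1) by simp
    ultimately show ?thesis using G(2) by simp
  qed
  have both: "real (?mex m) \<le> ?C * real m powr (real r / 2) \<and> real (a ^ r) \<le> real (?mex m)"
    if am: "(r * a) ^ 2 \<le> m" for a m
  proof -
    obtain G0 :: "nat sgraph" where G0: "simple_graph G0" "card (edges G0) = m" "graph_free ?F G0"
      "a ^ r \<le> card (copies (complete_graph r) G0)"
      using host[OF _ am small] assms(1) by auto
    have "real (?mex m) \<le> ?C * real m powr (real r / 2) \<and> card (copies (complete_graph r) G0) \<le> ?mex m"
      by (rule mex_bounds[OF G0(1-3)]) (rule upper)
    then show ?thesis using order_trans[OF G0(4)] of_nat_le_iff by blast
  qed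
  show "(\<lambda>m. real (?mex m)) \<in> \<Theta>(\<lambda>m. real m powr (real r / 2))"
  proof (rule bigthetaI)
    show "(\<lambda>m. real (?mex m)) \<in> O(\<lambda>m. real m powr (real r / 2))"
      \<comment> \<open>At \<open>a = 0\<close> the size condition holds for every
        \<open>m\<close>.\<close>
      using both[of 0] by (intro bigoI[of _ ?C] always_eventually) simp
    show "(\<lambda>m. real (?mex m)) \<in> \<Omega>(\<lambda>m. real m powr (real r / 2))"
    \<comment> \<open>The class size is the integer part of \<open>sqrt m / r\<close>, and rounding
      loses at most a factor 2; the \<open>r\<close>-th power gives this constant.\<close>
    proof (rule landau_omega.bigI[of "(1 / (2 * real r)) ^ r"])
      show "(1 / (2 * real r)) ^ r > 0" using assms(1) by simp
      show "eventually (\<lambda>m. norm (real (?mex m)) \<ge> (1 / (2 * real r)) ^ r * norm (real m powr (real r / 2)))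
          sequentially"
        \<comment> \<open>From this threshold on \<open>y \<ge> 2\<close>, so the integer part of
          \<open>y\<close> is at least \<open>y / 2\<close>.\<close>
        using eventually_ge_at_top[of "4 * r ^ 2"]
      proof eventually_elim
        case (elim m)
        define y where "y = sqrt (real m) / real r"
        have r0: "real r > 0" using assms(1) by simp
        have "(2 * real r) ^ 2 \<le> real m"
          using of_nat_mono[OF elim, where ?'a = real] by (simp add: power_mult_distrib)
        then have "2 * real r \<le> sqrt (real m)" by (rule real_le_rsqrt)
        then have y2: "y \<ge> 2" unfolding y_def using r0 by (simp add: field_simps)
        define a where "a = nat \<lfloor>y\<rfloor>"
        have a: "real a \<le> y" "y / 2 \<le> real a" unfolding a_def using y2 by linarith+
        have "real r * real a \<le> sqrt (real m)" using a(1) r0 by (simp add: y_def field_simps)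
        then have "(real r * real a) ^ 2 \<le> sqrt (real m) ^ 2" using r0 by (intro power_mono) auto
        then have "real ((r * a) ^ 2) \<le> real m" by simp
        then have "(r * a) ^ 2 \<le> m" by (simp only: of_nat_le_iff)
        then have "real a ^ r \<le> real (?mex m)" using both[of a m] by simp
        moreover have "(y / 2) ^ r \<le> real a ^ r" using a(2) y2 by (intro power_mono) auto
        moreover have "(y / 2) ^ r = (1 / (2 * real r)) ^ r * real m powr (real r / 2)"
        proof -
          have "m > 0" using elim assms(1) by (cases m) auto
          then have "sqrt (real m) ^ r = real m powr (real r / 2)"
            by (simp add: powr_powr flip: powr_half_sqrt powr_realpow)
          moreover have "(y / 2) ^ r = (1 / (2 * real r)) ^ r * sqrt (real m) ^ r"
            unfolding power_mult_distrib[symmetric] y_def by (simp add: mult.commute)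
          ultimately show ?thesis by simp
        qed
        ultimately have "(1 / (2 * real r)) ^ r * real m powr (real r / 2) \<le> real (?mex m)" by linarith
        then show ?case by simp
      qed
    qed
  qed
qed

end
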